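(* Let $p \geq 5$ be a prime and let $n$ be a non-negative integer with $n \leq p^4-1$ and $n$ not divisible by $p$. Suppose that the monomial $f = x^n$ is $2$-PN over $\mathbb{F}_{p^4}$. Then $n \in \{3,\, 2+p^2,\, 1+2p^2\}$.
   Context: $\mathbb{F}_q$ denotes the finite field with $q$ elements. For a polynomial $f \in \mathbb{F}_q[x]$ and $a_1,\dots,a_k \in \mathbb{F}_q$, the $k$-th finite difference of $f$ in directions $(a_1,\dots,a_k)$ is defined recursively by $\nabla_{a}^1 f = f(x+a)-f(x)$ and $\nabla_{a_1,\dots,a_k}^k f = g(x+a_k)-g(x)$, where $g(x) = \nabla_{a_1,\dots,a_{k-1}}^{k-1} f$. The polynomial $f$ is called $k$-PN over $\mathbb{F}_q$ if, for every choice of $(a_1,\dots,a_k)$ with all $a_i \in \mathbb{F}_q$ and $a_i \neq 0$, the function $\mathbb{F}_q \to \mathbb{F}_q$ associated to $\nabla_{a_1,\dots,a_k}^k f$ is a bijection. *)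

theory Defs
  imports "HOL-Computational_Algebra.Computational_Algebra" "HOL-Library.Cardinality"
begin

text \<open>
  The directions \<open>a\<^sub>1, \<dots>, a\<^sub>k\<close> are given by a function \<open>a\<close>, of which only the values at
  \<open>1, \<dots>, k\<close> are used. The substitution \<open>x \<mapsto> x + c\<close> is composition with \<open>[:c, 1:]\<close>.
\<close>

primrec finite_difference :: "nat \<Rightarrow> (nat \<Rightarrow> 'a) \<Rightarrow> 'a::comm_ring_1 poly \<Rightarrow> 'a poly" where
  "finite_difference 0 a f = f"
| "finite_difference (Suc k) a f =
     (let g = finite_difference k a f in pcompose g [:a (Suc k), 1:] - g)"

definition k_PN :: "nat \<Rightarrow> 'a::{finite, field} poly \<Rightarrow> bool" where
  "k_PN k f \<longleftrightarrow>
     (\<forall>a. (\<forall>i\<in>{1..k}. a i \<noteq> 0) \<longrightarrow> bij (poly (finite_difference k a f)))"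

end

theory Submission
  imports Defs
begin

text \<open>
  That \<open>x ^ n\<close> is 2-PN means that its second differences in nonzero directions are injective.
  Let \<open>K\<close> be the subfield with \<open>Q\<close> elements, where \<open>Q\<close> is \<open>p\<close> or \<open>p\<^sup>2\<close>, and let \<open>\<theta> \<noteq> 0\<close> satisfy
  \<open>\<theta> ^ Q = - \<theta>\<close>. For \<open>s\<close> in \<open>K\<close>, the second difference with directions \<open>s + \<theta>\<close> and \<open>s - \<theta>\<close>, taken at
  \<open>x - s\<close>, is \<open>(x + s) ^ n + (x - s) ^ n - (x + \<theta>) ^ n - (x - \<theta>) ^ n\<close>. The map \<open>y \<mapsto> y ^ Q\<close> only swaps
  the last two terms, so this function of \<open>x\<close> permutes \<open>K\<close>, and the sum of its \<open>m\<close>-th powers over \<open>K\<close>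
  vanishes for \<open>0 < m < Q - 1\<close>. The first two terms depend only on \<open>n\<close> modulo \<open>Q - 1\<close>, and the
  last two do not involve \<open>s\<close>. Every coefficient of a power of \<open>s\<close> in the vanishing sum is therefore a
  condition on \<open>(x + \<theta>) ^ n + (x - \<theta>) ^ n\<close> alone. Since \<open>(x + \<theta>) ^ Q = x - \<theta>\<close> on \<open>K\<close>, this last
  function is built from polynomials \<open>(x + \<theta>) ^ u * (x - \<theta>) ^ v\<close> whose exponents are base \<open>p\<close> digits,
  and the conditions say that certain coefficients close to the leading one vanish. These
  coefficients can be computed, and they vanish only if the digits are very small.

  Over the prime field an argument for planar functions gives \<open>n \<equiv> 3\<close> modulo
  \<open>p - 1\<close> (\<open>exponent_eq_3_over_prime_field\<close>). The two base \<open>p\<close> digits of \<open>n\<close> modulo \<open>p\<^sup>2 - 1\<close> then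
  add up to \<open>3\<close> or \<open>p + 2\<close>, and the method above with \<open>Q = p\<close> excludes \<open>p + 2\<close>
  (\<open>digit_sum_p_plus_2_contradiction\<close>). So \<open>n\<close> is one of \<open>3\<close>, \<open>p + 2\<close>, \<open>2 * p + 1\<close>, \<open>3 * p\<close> modulo
  \<open>p\<^sup>2 - 1\<close>, and composing with the Frobenius automorphism reduces to the first two.

  If \<open>n \<equiv> 3\<close>, then the digits of \<open>n\<close> in base \<open>p\<^sup>2\<close> add up to \<open>3\<close>, which is the conclusion, or to
  \<open>p\<^sup>2 + 2\<close>, which the method with \<open>Q = p\<^sup>2\<close> excludes (\<open>cubic_carry_contradiction\<close>).

  If \<open>n \<equiv> p + 2\<close>, four patterns of base \<open>p\<close> digits remain, and all are impossible
  (\<open>exponent_2_plus_p_contradiction\<close>). Three of them again contradict a coefficient condition. In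
  the fourth, \<open>x ^ n\<close> is a product of three conjugates of \<open>x\<close>, and the permutation of \<open>K\<close> is of the form
  \<open>\<alpha> * x ^ p + \<gamma> * x\<close>. It is singular as soon as \<open>\<alpha>\<close> and \<open>\<gamma>\<close> have the same norm, and an \<open>s\<close> that makes
  the norms equal is found by counting the elements of norm \<open>1\<close>
  (\<open>not_inj_on_of_norm_eq\<close>, \<open>exists_norm_one_square\<close>).
\<close>

section \<open>Roots of unity and subfields\<close>

lemma power_card_minus_1_eq_1:
  fixes x :: "'a::{finite, field}"
  assumes "x \<noteq> 0"
  shows "x ^ (CARD('a) - 1) = 1"
proof -
  have "(\<Prod>y\<in>UNIV - {0}. x * y) = (\<Prod>y\<in>UNIV - {0}. y)"
    by (rule prod.reindex_bij_witness[of _ "\<lambda>y. y / x" "\<lambda>y. x * y"]) (use assms in auto)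
  then have "x ^ (CARD('a) - 1) * \<Prod>(UNIV - {0}) = 1 * \<Prod>(UNIV - {0})"
    by (simp add: prod.distrib)
  moreover have "\<Prod>(UNIV - {0::'a}) \<noteq> 0"
    by simp
  ultimately show ?thesis
    by (metis mult_right_cancel)
qed

lemma card_roots_power_le:
  fixes c :: "'a::field"
  assumes "d > 0"
  shows "card {x. x ^ d = c} \<le> d"
proof -
  have deg: "degree (monom 1 d - [:c:]) = d"
    using assms by (intro antisym degree_diff_le le_degree) (auto simp: degree_monom_le coeff_pCons split: nat.splits)
  then have "monom 1 d - [:c:] \<noteq> 0"
    using assms by (metis degree_0 less_numeral_extra(3))
  from card_poly_roots_bound[OF this] show ?thesis
    unfolding deg by (simp add: poly_monom)
qed

text \<open>The polynomial \<open>x ^ (q - 1) - 1\<close> splits into distinct linear factors, hence so does its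
  divisor \<open>x ^ d - 1\<close>: neither it nor the cofactor can have more roots than its degree.\<close>

lemma card_roots_of_unity:
  assumes "d dvd CARD('a::{finite, field}) - 1"
  shows "card {x::'a. x ^ d = 1} = d"
proof -
  have card2: "CARD('a) \<ge> 2"
    using card_mono[of UNIV "{0, 1::'a}"] by simp
  obtain e where e: "CARD('a) - 1 = d * e"
    using assms by auto
  have pos: "d > 0" "e > 0"
    using e card2 by (auto intro!: Nat.gr0I)
  define C :: "'a poly" where "C = (\<Sum>i<e. monom 1 (d * i))"
  have degC: "degree C \<le> d * (e - 1)"
    unfolding C_def
    by (rule degree_sum_le) (auto intro!: order_trans[OF degree_monom_le])
  have "coeff C 0 = (\<Sum>i<e. if i = 0 then 1 else 0)"
    unfolding C_def coeff_sum using pos by (intro sum.cong) auto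
  also have "\<dots> = 1"
    using pos by simp
  finally have "C \<noteq> 0"
    by auto
  have polyC: "poly C x = (\<Sum>i<e. (x ^ d) ^ i)" for x
    unfolding C_def by (simp add: poly_sum poly_monom power_mult)
  have "UNIV - {0} \<subseteq> {x::'a. x ^ d = 1} \<union> {x. poly C x = 0}"
  proof
    fix x :: 'a
    assume "x \<in> UNIV - {0}"
    then have "(x ^ d) ^ e = 1"
      using power_card_minus_1_eq_1[of x] e by (simp add: power_mult)
    then have "(x ^ d - 1) * (\<Sum>i<e. (x ^ d) ^ i) = 0"
      by (metis diff_self power_diff_1_eq)
    then show "x \<in> {x. x ^ d = 1} \<union> {x. poly C x = 0}"
      using polyC by auto
  qed
  then have "card (UNIV - {0::'a}) \<le> card ({x::'a. x ^ d = 1} \<union> {x. poly C x = 0})"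
    by (intro card_mono) auto
  also have "\<dots> \<le> card {x::'a. x ^ d = 1} + card {x. poly C x = 0}"
    by (rule card_Un_le)
  also have "card {x. poly C x = 0} \<le> d * (e - 1)"
    using card_poly_roots_bound[OF \<open>C \<noteq> 0\<close>] degC by simp
  finally have "d * e \<le> card {x::'a. x ^ d = 1} + d * (e - 1)"
    using e by (simp add: card_Diff_singleton)
  moreover have "d * e = d + d * (e - 1)"
    using pos by (cases e) auto
  ultimately have "d \<le> card {x::'a. x ^ d = 1}"
    by simp
  then show ?thesis
    using card_roots_power_le[OF pos(1), of "1::'a"] by simp
qed

text \<open>The roots of \<open>x ^ Q - x\<close>. When \<open>Q\<close> is a power of the characteristic this is a subfield, kept as a
  set because several subfields of one field type are needed at once.\<close>

definition fixed_field :: "nat \<Rightarrow> 'a::field set" where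
  "fixed_field Q = {x. x ^ Q = x}"

locale quartic_field =
  fixes p :: nat and F :: "'a::{finite, field} itself"
  assumes prime: "prime p" and p_ge_5: "p \<ge> 5" and card: "CARD('a) = p ^ 4"
begin

lemma CHAR_eq: "CHAR('a) = p"
proof -
  have "prime CHAR('a)"
    by (rule prime_CHAR_semidom[OF finite_imp_CHAR_pos]) simp
  moreover have "CHAR('a) dvd p ^ 4"
  proof -
    have "(\<Sum>x\<in>UNIV. x + 1 :: 'a) = (\<Sum>x\<in>UNIV. x)"
      by (rule sum.reindex_bij_witness[of _ "\<lambda>x. x - 1" "\<lambda>x. x + 1"]) auto
    then have "of_nat CARD('a) = (0::'a)"
      by (simp add: sum.distrib)
    then show ?thesis
      by (simp only: of_nat_eq_0_iff_char_dvd card)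
  qed
  ultimately show ?thesis
    using prime by (metis prime_dvd_power primes_dvd_imp_eq)
qed

lemma of_nat_eq_0_iff: "of_nat k = (0::'a) \<longleftrightarrow> p dvd k"
  by (simp add: of_nat_eq_0_iff_char_dvd CHAR_eq)

lemma of_nat_nonzero: "0 < k \<Longrightarrow> k < p \<Longrightarrow> of_nat k \<noteq> (0::'a)"
  by (auto simp: of_nat_eq_0_iff dest: dvd_imp_le)

lemma numerals_nonzero: "(2::'a) \<noteq> 0" "(3::'a) \<noteq> 0" "(4::'a) \<noteq> 0" "(6::'a) \<noteq> 0"
proof -
  show a: "(2::'a) \<noteq> 0" "(3::'a) \<noteq> 0" "(4::'a) \<noteq> 0"
    using of_nat_nonzero[of 2] of_nat_nonzero[of 3] of_nat_nonzero[of 4] p_ge_5 by simp_all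
  have "(6::'a) = 2 * 3"
    by simp
  with a show "(6::'a) \<noteq> 0"
    by (metis mult_eq_0_iff)
qed

lemma odd_p: "odd p"
  using prime p_ge_5 prime_odd_nat by auto

lemma frobenius_add: "(x + y :: 'a) ^ (p ^ k) = x ^ (p ^ k) + y ^ (p ^ k)"
  by (rule freshmans_dream') (use prime CHAR_eq in auto)

lemma frobenius_minus: "(- x :: 'a) ^ (p ^ k) = - (x ^ (p ^ k))"
  using odd_p by (simp add: power_minus_odd)

lemma frobenius_diff: "(x - y :: 'a) ^ (p ^ k) = x ^ (p ^ k) - y ^ (p ^ k)"
  using frobenius_add[of x "- y" k] by (simp add: frobenius_minus)

lemma frobenius_sum: "(\<Sum>i\<in>A. f i :: 'a) ^ (p ^ k) = (\<Sum>i\<in>A. f i ^ (p ^ k))"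
  by (rule freshmans_dream_sum') (use prime CHAR_eq in auto)

lemma frobenius_of_nat: "(of_nat k :: 'a) ^ (p ^ j) = of_nat k"
proof (induction k)
  case 0
  show ?case using prime_gt_0_nat[OF prime] by simp
next
  case (Suc k)
  then show ?case by (simp add: frobenius_add)
qed

lemma frobenius_numeral: "(numeral k :: 'a) ^ (p ^ j) = numeral k"
  using frobenius_of_nat[of "numeral k" j] by simp

end

locale quartic_subfield = quartic_field p F for p and F :: "'a::{finite, field} itself" +
  fixes Q :: nat
  assumes Q: "Q = p \<or> Q = p\<^sup>2"
begin

abbreviation K :: "'a set" where "K \<equiv> fixed_field Q"

lemma Q_power: obtains k where "Q = p ^ k"
  using Q that[of 1] that[of 2] by auto

lemma add_power_Q: "(x + y :: 'a) ^ Q = x ^ Q + y ^ Q"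
  and diff_power_Q: "(x - y :: 'a) ^ Q = x ^ Q - y ^ Q"
  and of_nat_power_Q: "(of_nat k :: 'a) ^ Q = of_nat k"
  and numeral_power_Q: "(numeral l :: 'a) ^ Q = numeral l"
  by (rule Q_power, simp add: frobenius_add frobenius_diff frobenius_of_nat frobenius_numeral)+

lemma Q_ge_5: "Q \<ge> 5"
proof -
  have "p \<le> p\<^sup>2"
    by (simp add: power2_nat_le_imp_le power2_eq_square)
  then show ?thesis
    using Q p_ge_5 by auto
qed

lemma odd_Q: "odd Q"
  using Q odd_p by auto

lemma two_Q_minus_1_dvd: "2 * (Q - 1) dvd CARD('a) - 1"
proof -
  have r: "R\<^sup>2 - 1 = (R - 1) * (R + 1)" for R :: nat
    by (cases R) (auto simp: power2_eq_square algebra_simps)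
  have eq: "CARD('a) - 1 = (p\<^sup>2 - 1) * (p\<^sup>2 + 1)"
    using r[of "p\<^sup>2"] card by (simp flip: power_mult)
  have ev: "2 dvd p\<^sup>2 + 1"
    using odd_p by simp
  have ev': "2 dvd p + 1"
    using odd_p by simp
  show ?thesis
  proof (cases "Q = p")
    case True
    have "2 * (p - 1) dvd (p + 1) * (p - 1)"
      by (rule mult_dvd_mono) (use ev' in auto)
    then have "2 * (p - 1) dvd (p\<^sup>2 - 1)"
      by (simp only: r mult.commute)
    then show ?thesis
      unfolding True eq by (rule dvd_mult2)
  next
    case False
    then have "Q = p\<^sup>2"
      using Q by auto
    have "2 * (p\<^sup>2 - 1) dvd (p\<^sup>2 + 1) * (p\<^sup>2 - 1)"
      by (rule mult_dvd_mono) (use ev in auto)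
    then show ?thesis
      unfolding eq \<open>Q = p\<^sup>2\<close> by (simp only: mult.commute)
  qed
qed

lemma K_closed [intro, simp]:
  "0 \<in> K" "1 \<in> K"
  "x \<in> K \<Longrightarrow> y \<in> K \<Longrightarrow> x + y \<in> K"
  "x \<in> K \<Longrightarrow> y \<in> K \<Longrightarrow> x - y \<in> K"
  "x \<in> K \<Longrightarrow> y \<in> K \<Longrightarrow> x * y \<in> K"
  "x \<in> K \<Longrightarrow> y \<in> K \<Longrightarrow> x / y \<in> K"
  "x \<in> K \<Longrightarrow> x ^ k \<in> K"
  "of_nat k \<in> K" "numeral l \<in> K"
  using Q_ge_5 power_mult[of x Q k] power_mult[of x k Q]
  by (auto simp: fixed_field_def add_power_Q diff_power_Q power_mult_distrib
      power_divide of_nat_power_Q numeral_power_Q power_0_left mult.commute)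

lemma K_minus [intro, simp]: "x \<in> K \<Longrightarrow> - x \<in> K"
  using K_closed(4)[of 0 x] by simp

lemma K_nonzero: "x \<in> K \<Longrightarrow> x \<noteq> 0 \<Longrightarrow> x ^ (Q - 1) = 1"
  using power_minus_mult[of Q x] Q_ge_5 by (simp add: fixed_field_def)

lemma K_eq: "K = insert 0 {x. x ^ (Q - 1) = 1}"
proof -
  have "x \<in> K" if "x ^ (Q - 1) = 1" for x :: 'a
    using that power_minus_mult[of Q x] Q_ge_5 by (simp add: fixed_field_def)
  then show ?thesis
    using K_nonzero by auto
qed

lemma card_K: "card K = Q"
proof -
  have "card {x::'a. x ^ (Q - 1) = 1} = Q - 1"
    by (rule card_roots_of_unity) (use two_Q_minus_1_dvd in \<open>auto elim: dvd_mult_right\<close>)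
  moreover have "0 \<notin> {x::'a. x ^ (Q - 1) = 1}"
    using Q_ge_5 by (auto simp: power_0_left)
  ultimately show ?thesis
    unfolding K_eq using Q_ge_5 by simp
qed

text \<open>Only half of the roots of \<open>x ^ (2 * (Q - 1)) = 1\<close> satisfy \<open>x ^ (Q - 1) = 1\<close>; the others satisfy
  \<open>x ^ (Q - 1) = - 1\<close>.\<close>

lemma obtain_anti_invariant: obtains \<theta> :: 'a where "\<theta> \<noteq> 0" "\<theta> ^ Q = - \<theta>"
proof -
  let ?A = "{x::'a. x ^ (2 * (Q - 1)) = 1}" and ?B = "{x::'a. x ^ (Q - 1) = 1}"
  have "card ?B = Q - 1"
    by (rule card_roots_of_unity) (use two_Q_minus_1_dvd in \<open>auto elim: dvd_mult_right\<close>)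
  moreover have "card ?A = 2 * (Q - 1)"
    by (rule card_roots_of_unity[OF two_Q_minus_1_dvd])
  ultimately have "card ?B < card ?A"
    using Q_ge_5 by simp
  then have "\<not> ?A \<subseteq> ?B"
    using card_mono[of ?B ?A] by auto
  then obtain \<theta> :: 'a where t: "\<theta> ^ (2 * (Q - 1)) = 1" "\<theta> ^ (Q - 1) \<noteq> 1"
    by auto
  have "(\<theta> ^ (Q - 1))\<^sup>2 = 1"
    using t(1) by (simp add: mult.commute flip: power_mult)
  then have "\<theta> ^ (Q - 1) = - 1"
    using t(2) power2_eq_1_iff by blast
  moreover have "\<theta> ^ Q = \<theta> ^ (Q - 1) * \<theta>"
    using power_minus_mult[of Q \<theta>] Q_ge_5 by simp
  moreover have "\<theta> \<noteq> 0"
    using t(1) Q_ge_5 by (auto simp: power_0_left)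
  ultimately show ?thesis
    using that by simp
qed

text \<open>If \<open>Q - 1\<close> does not divide \<open>j\<close>, some nonzero \<open>g\<close> has \<open>g ^ j \<noteq> 1\<close>, and multiplication
  by \<open>g\<close> permutes the subfield.\<close>

lemma sum_power:
  "(\<Sum>x\<in>K. x ^ j) = (if 0 < j \<and> (Q - 1) dvd j then - 1 else 0)"
proof -
  have 0: "0 \<in> K" by simp
  have Q0: "of_nat Q = (0::'a)"
    using Q by (auto simp: of_nat_eq_0_iff)
  consider "j = 0" | "0 < j" "(Q - 1) dvd j" | "0 < j" "\<not> (Q - 1) dvd j"
    by auto
  then show ?thesis
  proof cases
    case 1
    then show ?thesis
      using card_K Q0 by simp
  next
    case 2
    have "(\<Sum>x\<in>K. x ^ j) = (\<Sum>x\<in>K - {0}. x ^ j)"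
      using 2 by (subst sum.remove[OF _ 0]) (auto simp: power_0_left)
    also have "\<dots> = (\<Sum>x\<in>K - {0}. 1)"
      by (rule sum.cong) (use 2 K_nonzero in \<open>auto simp: power_mult elim!: dvdE\<close>)
    also have "\<dots> = of_nat (Q - 1)"
      using card_K by (simp add: card_Diff_singleton)
    also have "\<dots> = - 1"
      using Q0 Q_ge_5 by (simp add: of_nat_diff)
    finally show ?thesis
      using 2 by simp
  next
    case 3
    define r where "r = j mod (Q - 1)"
    have r: "0 < r" "r < Q - 1"
      using 3 Q_ge_5 by (auto simp: r_def dvd_eq_mod_eq_0)
    have "\<not> K - {0} \<subseteq> {x. x ^ r = 1}"
    proof
      assume "K - {0} \<subseteq> {x. x ^ r = 1}"
      then have "card (K - {0}) \<le> card {x::'a. x ^ r = 1}"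
        by (intro card_mono) auto
      also have "\<dots> \<le> r"
        by (rule card_roots_power_le[OF r(1)])
      finally show False
        using r card_K by (simp add: card_Diff_singleton)
    qed
    then obtain g where g: "g \<in> K" "g \<noteq> 0" "g ^ r \<noteq> 1"
      by auto
    have "g ^ j = g ^ (r + (Q - 1) * (j div (Q - 1)))"
      by (simp add: r_def)
    also have "\<dots> = g ^ r"
      using K_nonzero[OF g(1,2)] by (simp add: power_add power_mult)
    finally have gj: "g ^ j \<noteq> 1"
      using g by simp
    have "(\<Sum>x\<in>K. x ^ j) = (\<Sum>x\<in>K. (g * x) ^ j)"
      by (rule sum.reindex_bij_witness[of _ "\<lambda>x. g * x" "\<lambda>x. x / g"]) (use g in auto)
    also have "\<dots> = g ^ j * (\<Sum>x\<in>K. x ^ j)"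
      by (simp add: power_mult_distrib sum_distrib_left)
    finally have "(g ^ j - 1) * (\<Sum>x\<in>K. x ^ j) = 0"
      by (simp add: algebra_simps)
    then show ?thesis
      using gj 3 by simp
  qed
qed

lemma sum_poly:
  assumes "degree P < 2 * (Q - 1)"
  shows "(\<Sum>x\<in>K. poly P x) = - coeff P (Q - 1)"
proof -
  have "(\<Sum>x\<in>K. poly P x) = (\<Sum>i\<le>degree P. coeff P i * (\<Sum>x\<in>K. x ^ i))"
    by (subst sum_distrib_left, subst sum.swap) (simp add: poly_altdef)
  also have "\<dots> = (\<Sum>i\<le>degree P. if i = Q - 1 then - coeff P i else 0)"
  proof (rule sum.cong)
    fix i
    assume "i \<in> {..degree P}"
    then have "i < 2 * (Q - 1)"
      using assms by simp
    then have "0 < i \<and> (Q - 1) dvd i \<longleftrightarrow> i = Q - 1"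
      using Q_ge_5 by (auto elim!: dvdE)
    then show "coeff P i * (\<Sum>x\<in>K. x ^ i) = (if i = Q - 1 then - coeff P i else 0)"
      unfolding sum_power by simp
  qed simp
  also have "\<dots> = - coeff P (Q - 1)"
    by (auto simp: coeff_eq_0)
  finally show ?thesis .
qed

text \<open>The easy half of Hermite's criterion: a permutation has the power sums of the identity.\<close>

lemma sum_power_permutation:
  assumes "inj_on g K" and "\<And>x. x \<in> K \<Longrightarrow> g x \<in> K" and "0 < m" and "m < Q - 1"
  shows "(\<Sum>x\<in>K. g x ^ m) = 0"
proof -
  have "g ` K = K"
    by (rule endo_inj_surj) (use assms in auto)
  have "(\<Sum>x\<in>K. g x ^ m) = (\<Sum>x\<in>g ` K. x ^ m)"
    using assms(1) by (simp add: sum.reindex)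
  also have "\<dots> = 0"
    unfolding \<open>g ` K = K\<close> sum_power using assms(3,4) by (auto dest: dvd_imp_le)
  finally show ?thesis .
qed

end

section \<open>Coefficients of balanced products\<close>

lemma dvd_less_double_imp_eq: "(d::nat) dvd m \<Longrightarrow> 0 < m \<Longrightarrow> m < 2 * d \<Longrightarrow> m = d"
proof (elim dvdE)
  fix k
  assume "0 < m" "m < 2 * d" and k: "m = d * k"
  then have "k < 2" "k \<noteq> 0"
    by (auto simp: mult.commute[of d])
  then show "m = d"
    using k by (simp add: less_2_cases_iff)
qed

lemma sum_reverse_order:
  "(\<Sum>s\<in>A. \<Sum>x\<in>B. \<Sum>l\<in>C. f s x l) = (\<Sum>l\<in>C. \<Sum>x\<in>B. \<Sum>s\<in>A. f s x l)"
proof -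
  have "(\<Sum>s\<in>A. \<Sum>x\<in>B. \<Sum>l\<in>C. f s x l) = (\<Sum>s\<in>A. \<Sum>l\<in>C. \<Sum>x\<in>B. f s x l)"
    by (intro sum.cong refl) (rule sum.swap)
  also have "\<dots> = (\<Sum>l\<in>C. \<Sum>s\<in>A. \<Sum>x\<in>B. f s x l)"
    by (rule sum.swap)
  also have "\<dots> = (\<Sum>l\<in>C. \<Sum>x\<in>B. \<Sum>s\<in>A. f s x l)"
    by (intro sum.cong refl) (rule sum.swap)
  finally show ?thesis .
qed

text \<open>On a subfield with \<open>Q\<close> elements and for \<open>\<theta> ^ Q = - \<theta>\<close>, the power \<open>(x + \<theta>) ^ (u + Q * v)\<close> takes the
  values of this polynomial.\<close>

definition balanced_poly :: "'a::idom \<Rightarrow> nat \<Rightarrow> nat \<Rightarrow> 'a poly" where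
  "balanced_poly \<theta> u v = [:\<theta>, 1:] ^ u * [:- \<theta>, 1:] ^ v"

lemma poly_balanced_poly: "poly (balanced_poly \<theta> u v) x = (x + \<theta>) ^ u * (x - \<theta>) ^ v"
  by (simp add: balanced_poly_def add.commute)

lemma degree_balanced_poly: "degree (balanced_poly \<theta> u v) = u + v"
  unfolding balanced_poly_def by (subst degree_mult_eq) (auto simp: degree_power_eq)

lemma coeff_balanced_poly_top: "coeff (balanced_poly \<theta> u v) (u + v) = 1"
proof -
  have "lead_coeff (balanced_poly \<theta> u v) = 1"
    unfolding balanced_poly_def by (simp add: lead_coeff_mult lead_coeff_power)
  then show ?thesis
    by (simp add: degree_balanced_poly)
qed

text \<open>Comparison of coefficients in the differential equation
  \<open>(x\<^sup>2 - \<theta>\<^sup>2) * P' = ((u + v) * x + (v - u) * \<theta>) * P\<close> satisfied by \<open>P = (x + \<theta>) ^ u * (x - \<theta>) ^ v\<close>.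
  It determines the coefficients from the leading one downwards.\<close>

lemma coeff_balanced_poly_rec:
  fixes \<theta> :: "'a::idom" and u v j :: nat
  defines "c \<equiv> coeff (balanced_poly \<theta> u v)"
  shows "(of_nat (u + v) - of_nat j) * c j =
    (of_nat u - of_nat v) * \<theta> * c (j + 1) - \<theta>\<^sup>2 * of_nat (j + 2) * c (j + 2)"
proof -
  define P where "P = balanced_poly \<theta> u v"
  have step: "pderiv ([:a, 1:] ^ k) * [:a, 1:] = smult (of_nat k) ([:a, 1:] ^ k)" for a :: 'a and k
  proof (cases k)
    case (Suc m)
    have "pderiv [:a, 1:] = 1"
      by (simp add: pderiv_pCons)
    then show ?thesis
      unfolding Suc pderiv_power_Suc by (simp only: mult_1_right mult_smult_left power_Suc2)
  qed simp
  have "pderiv P * ([:\<theta>, 1:] * [:- \<theta>, 1:]) =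
      (pderiv ([:\<theta>, 1:] ^ u) * [:\<theta>, 1:]) * [:- \<theta>, 1:] ^ v * [:- \<theta>, 1:] +
      (pderiv ([:- \<theta>, 1:] ^ v) * [:- \<theta>, 1:]) * [:\<theta>, 1:] ^ u * [:\<theta>, 1:]"
    unfolding P_def balanced_poly_def pderiv_mult by (simp only: algebra_simps)
  also have "\<dots> = P * (smult (of_nat u) [:- \<theta>, 1:] + smult (of_nat v) [:\<theta>, 1:])"
    unfolding step P_def balanced_poly_def by (simp only: algebra_simps mult_smult_left mult_smult_right)
  finally have "coeff (pderiv P * ([:\<theta>, 1:] * [:- \<theta>, 1:])) (Suc j) =
      coeff (P * (smult (of_nat u) [:- \<theta>, 1:] + smult (of_nat v) [:\<theta>, 1:])) (Suc j)"
    by simp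
  then have "of_nat j * coeff P j - \<theta>\<^sup>2 * of_nat (j + 2) * coeff P (j + 2) =
     (of_nat v - of_nat u) * \<theta> * coeff P (j + 1) + of_nat (u + v) * coeff P j"
    by (cases j) (simp_all add: coeff_pderiv algebra_simps power2_eq_square)
  then show ?thesis
    unfolding c_def P_def[symmetric] by (simp add: algebra_simps)
qed

lemma coeff_balanced_poly_minus_2:
  fixes \<theta> :: "'a::idom"
  assumes "u + v \<ge> 2"
  shows "2 * coeff (balanced_poly \<theta> u v) (u + v - 2) = \<theta>\<^sup>2 * ((of_nat u - of_nat v)\<^sup>2 - of_nat (u + v))"
proof -
  let ?c = "coeff (balanced_poly \<theta> u v)" and ?\<delta> = "of_nat u - of_nat v :: 'a"
  have 0: "?c (u + v) = 1"
    by (rule coeff_balanced_poly_top)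
  have "?c (u + v + 1) = 0"
    by (rule coeff_eq_0) (simp add: degree_balanced_poly)
  moreover have "u + v - 1 + 1 = u + v" "u + v - 1 + 2 = u + v + 1"
    using assms by auto
  ultimately have 1: "?c (u + v - 1) = ?\<delta> * \<theta>"
    using coeff_balanced_poly_rec[of u v "u + v - 1" \<theta>] assms 0
    by (simp add: of_nat_diff)
  have "u + v - 2 + 1 = u + v - 1" "u + v - 2 + 2 = u + v"
    using assms by auto
  moreover have "of_nat (u + v) - of_nat (u + v - 2) = (2::'a)"
    using assms by (simp add: of_nat_diff)
  ultimately have "2 * ?c (u + v - 2) = ?\<delta> * \<theta> * (?\<delta> * \<theta>) - \<theta>\<^sup>2 * of_nat (u + v)"
    using coeff_balanced_poly_rec[of u v "u + v - 2" \<theta>] 0 1 by simp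
  then show ?thesis
    by (simp add: power2_eq_square algebra_simps)
qed

text \<open>When \<open>u + v\<close> equals \<open>2\<close> in the field, the right-hand side is \<open>16 * \<theta> ^ 4 * u * (u - 1)\<^sup>2 * (u - 2)\<close>.
  This is how the digits \<open>0\<close>, \<open>1\<close>, \<open>2\<close> are singled out among all digits.\<close>

lemma coeff_balanced_poly_minus_4:
  fixes \<theta> :: "'a::idom" and u v :: nat
  assumes "u + v \<ge> 4" and w: "of_nat (u + v) = (2::'a)"
  defines "\<delta> \<equiv> of_nat u - of_nat v"
  shows "24 * coeff (balanced_poly \<theta> u v) (u + v - 4) = \<theta> ^ 4 * \<delta>\<^sup>2 * (\<delta>\<^sup>2 - 4)"
proof -
  let ?c = "coeff (balanced_poly \<theta> u v)"
  note rec = coeff_balanced_poly_rec[of u v _ \<theta>, folded \<delta>_def]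
  have 0: "?c (u + v) = 1"
    by (rule coeff_balanced_poly_top)
  have "?c (u + v + 1) = 0"
    by (rule coeff_eq_0) (simp add: degree_balanced_poly)
  moreover have "u + v - 1 + 1 = u + v" "u + v - 1 + 2 = u + v + 1"
    using assms by auto
  ultimately have 1: "?c (u + v - 1) = \<delta> * \<theta>"
    using rec[of "u + v - 1"] assms(1) 0 by (simp add: of_nat_diff)
  have 2: "2 * ?c (u + v - 2) = \<theta>\<^sup>2 * (\<delta>\<^sup>2 - 2)"
    using coeff_balanced_poly_minus_2[of u v \<theta>] assms(1) unfolding w \<delta>_def by simp
  have *: "u + v - 3 + 1 = u + v - 2" "u + v - 3 + 2 = u + v - 1"
          "u + v - 4 + 1 = u + v - 3" "u + v - 4 + 2 = u + v - 2"
    using assms(1) by auto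
  have **: "of_nat (u + v - k) = (2 - of_nat k :: 'a)" if "k \<le> 4" for k
    using that assms(1) w by (simp add: of_nat_diff)
  have 3: "3 * ?c (u + v - 3) = \<delta> * \<theta> * ?c (u + v - 2) - \<theta>\<^sup>2 * (\<delta> * \<theta>)"
    using rec[of "u + v - 3"] unfolding * w 1 by (simp add: **)
  have 4: "4 * ?c (u + v - 4) = \<delta> * \<theta> * ?c (u + v - 3)"
    using rec[of "u + v - 4"] unfolding * w by (simp add: **)
  have "24 * ?c (u + v - 4) = 6 * (4 * ?c (u + v - 4))"
    by simp
  also have "\<dots> = 2 * \<delta> * \<theta> * (3 * ?c (u + v - 3))"
    unfolding 4 by simp
  also have "\<dots> = \<delta> * \<theta> * (\<delta> * \<theta> * (2 * ?c (u + v - 2)) - 2 * \<theta>\<^sup>2 * (\<delta> * \<theta>))"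
    unfolding 3 by (simp add: algebra_simps)
  also have "\<dots> = \<theta> ^ 4 * \<delta>\<^sup>2 * (\<delta>\<^sup>2 - 4)"
    unfolding 2 by (simp add: algebra_simps power2_eq_square power4_eq_xxxx)
  finally show ?thesis .
qed

text \<open>Replacing \<open>\<theta>\<close> by \<open>- \<theta>\<close> amounts to replacing \<open>x\<close> by \<open>- x\<close>, up to the sign \<open>(- 1) ^ (u + v)\<close>.\<close>

lemma coeff_balanced_poly_uminus:
  "coeff (balanced_poly (- \<theta>) u v) j = (- 1) ^ (u + v + j) * coeff (balanced_poly \<theta> u v) j"
proof -
  have coeff_reflect: "coeff (P \<circ>\<^sub>p [:0, - 1:]) k = (- 1) ^ k * coeff P k" for P :: "'a poly" and k
  proof (induction P arbitrary: k)
    case (pCons a P)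
    then show ?case
      by (cases k) (simp_all add: pcompose_pCons)
  qed simp
  have pcompose_power: "P ^ k \<circ>\<^sub>p R = (P \<circ>\<^sub>p R) ^ k" for P R :: "'a poly" and k
    by (induction k) (simp_all add: pcompose_mult pcompose_1)
  have "[:\<theta>, 1:] \<circ>\<^sub>p [:0, - 1:] = - [:- \<theta>, 1:]" "[:- \<theta>, 1:] \<circ>\<^sub>p [:0, - 1:] = - [:\<theta>, 1:]"
    by (simp_all add: pcompose_pCons)
  then have "balanced_poly \<theta> u v \<circ>\<^sub>p [:0, - 1:] = (- [:- \<theta>, 1:]) ^ u * (- [:\<theta>, 1:]) ^ v"
    by (simp only: balanced_poly_def pcompose_mult pcompose_power)
  also have "\<dots> = (- 1) ^ (u + v) * balanced_poly (- \<theta>) u v"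
    unfolding power_minus[of "[:- \<theta>, 1:]"] power_minus[of "[:\<theta>, 1:]"] balanced_poly_def power_add minus_minus
    by (simp only: ac_simps)
  finally have "coeff (balanced_poly \<theta> u v \<circ>\<^sub>p [:0, - 1:]) j = coeff ((- 1) ^ (u + v) * balanced_poly (- \<theta>) u v) j"
    by simp
  then have "(- 1) ^ j * coeff (balanced_poly \<theta> u v) j = (- 1) ^ (u + v) * coeff (balanced_poly (- \<theta>) u v) j"
    unfolding coeff_reflect by (cases "even (u + v)") simp_all
  then have "(- 1) ^ (u + v) * ((- 1) ^ j * coeff (balanced_poly \<theta> u v) j) =
      ((- 1) ^ (u + v) * (- 1) ^ (u + v)) * coeff (balanced_poly (- \<theta>) u v) j"
    by (simp only: mult.assoc)
  also have "(- 1) ^ (u + v) * (- 1) ^ (u + v) = (1::'a)"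
    by (simp flip: power_mult_distrib)
  finally show ?thesis
    unfolding power_add[of _ "u + v" j] by (simp only: mult.assoc mult_1_left)
qed

section \<open>Second differences of power functions\<close>

definition second_difference :: "nat \<Rightarrow> 'a::comm_ring_1 \<Rightarrow> 'a \<Rightarrow> 'a \<Rightarrow> 'a" where
  "second_difference n a b x = (x + a + b) ^ n - (x + a) ^ n - (x + b) ^ n + x ^ n"

context quartic_field
begin

definition power_2PN :: "nat \<Rightarrow> bool" where
  "power_2PN n \<longleftrightarrow> (\<forall>a b :: 'a. a \<noteq> 0 \<longrightarrow> b \<noteq> 0 \<longrightarrow> inj (second_difference n a b))"

lemma of_nat_binomial_nonzero:
  assumes "k \<le> m" and "m < p"
  shows "of_nat (m choose k) \<noteq> (0::'a)"
proof
  assume "of_nat (m choose k) = (0::'a)"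
  then have "p dvd (fact k * fact (m - k) * (m choose k) :: nat)"
    by (simp add: of_nat_eq_0_iff)
  then have "p dvd fact m"
    using binomial_fact_lemma[OF assms(1)] by simp
  then show False
    using prime_dvd_fact_iff[OF prime] assms(2) by simp
qed

text \<open>Let \<open>v\<close> be a primitive cube root of unity. Because \<open>1 + v + v\<^sup>2 = 0\<close>, the sum of two of the numbers
  \<open>1\<close>, \<open>v\<close>, \<open>v\<^sup>2\<close> is minus the third. For odd \<open>n\<close> the second differences with directions \<open>1\<close>, \<open>v\<close> at \<open>0\<close>
  and at \<open>v\<^sup>2\<close> are therefore negatives of each other, namely \<open>1 + v ^ n + v ^ (2 * n)\<close> up to sign. Both
  are \<open>0\<close> unless \<open>3\<close> divides \<open>n\<close>.\<close>

lemma power_2PN_imp_3_dvd: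
  assumes "power_2PN n" and "odd n"
  shows "3 dvd n"
proof (rule ccontr)
  assume n3: "\<not> 3 dvd n"
  have "3 dvd CARD('a) - 1"
  proof -
    have "p mod 3 \<noteq> 0"
      using prime p_ge_5 by (auto simp: prime_nat_iff dvd_eq_mod_eq_0[symmetric])
    then have "p mod 3 = 1 \<or> p mod 3 = 2"
      by linarith
    then have "p ^ 4 mod 3 = 1"
      by (auto simp: power_mod[of p 3, symmetric])
    then show ?thesis
      unfolding card by presburger
  qed
  then have "card {x::'a. x ^ 3 = 1} = 3"
    by (rule card_roots_of_unity)
  moreover have "card {1::'a} = 1"
    by simp
  ultimately have "\<not> {x::'a. x ^ 3 = 1} \<subseteq> {1}"
    using card_mono[of "{1::'a}" "{x::'a. x ^ 3 = 1}"] by auto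
  then obtain v :: 'a where v: "v ^ 3 = 1" "v \<noteq> 1"
    by auto
  have "(v - 1) * (1 + v + v\<^sup>2) = v ^ 3 - 1"
    by (simp add: algebra_simps power2_eq_square power3_eq_cube)
  with v have v2: "1 + v + v\<^sup>2 = 0"
    by simp
  have v0: "v \<noteq> 0"
    using v by auto
  have "v ^ n = v ^ (n mod 3 + 3 * (n div 3))"
    by simp
  also have "\<dots> = v ^ (n mod 3)"
    by (simp only: power_add power_mult v(1) power_one mult_1_right)
  finally have vn: "v ^ n = v ^ (n mod 3)" .
  have "n mod 3 = 1 \<or> n mod 3 = 2"
    using n3 by (auto simp: dvd_eq_mod_eq_0)
  then have sum0: "1 + v ^ n + (v ^ n)\<^sup>2 = 0"
  proof
    assume "n mod 3 = 2"
    then have "1 + v ^ n + (v ^ n)\<^sup>2 = 1 + v\<^sup>2 + v ^ 3 * v"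
      unfolding vn by (simp add: power2_eq_square power3_eq_cube)
    then show ?thesis
      using v v2 by (simp add: ac_simps)
  qed (use v2 vn in simp)
  have e: "1 + v = - v\<^sup>2" "v\<^sup>2 + 1 = - v" "v\<^sup>2 + v = - 1" "v\<^sup>2 + 1 + v = 0"
    using v2 by (simp_all add: eq_neg_iff_add_eq_0 ac_simps)
  have n0: "n > 0"
    using assms(2) by (auto intro: Nat.gr0I)
  have sq: "(v\<^sup>2) ^ n = (v ^ n)\<^sup>2"
    by (simp flip: power_mult add: mult.commute)
  have "second_difference n 1 v (v\<^sup>2) = 1 + v ^ n + (v ^ n)\<^sup>2"
    unfolding second_difference_def e using assms(2) n0 sq by (simp add: power_0_left)
  moreover have "second_difference n 1 v 0 = - (1 + v ^ n + (v ^ n)\<^sup>2)"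
    unfolding second_difference_def using e assms(2) n0 sq by (simp add: power_0_left)
  ultimately have "second_difference n 1 v (v\<^sup>2) = second_difference n 1 v 0"
    using sum0 by simp
  moreover have "inj (second_difference n 1 v)"
    using assms(1) v0 by (simp add: power_2PN_def)
  ultimately have "v\<^sup>2 = 0"
    by (blast dest: injD)
  then show False
    using v0 by simp
qed

end

context quartic_subfield
begin

text \<open>The second difference at \<open>x - s\<close> with directions \<open>s + \<theta>\<close> and \<open>s - \<theta>\<close>. The directions are nonzero
  because \<open>\<theta>\<close> is not in the subfield.\<close>

lemma inj_on_symmetric_difference:
  fixes \<theta> :: 'a
  assumes "power_2PN n" and "\<theta> \<noteq> 0" and \<theta>: "\<theta> ^ Q = - \<theta>" and s: "s \<in> K"
  shows "inj_on (\<lambda>x. (x + s) ^ n + (x - s) ^ n - (x + \<theta>) ^ n - (x - \<theta>) ^ n) K" (is "inj_on ?g K")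
proof -
  have ne: "\<theta> \<notin> K" "- \<theta> \<notin> K"
    using assms(2) \<theta> odd_Q numerals_nonzero(1) by (auto simp: fixed_field_def)
  have ne': "s + \<theta> \<noteq> 0" "s - \<theta> \<noteq> 0"
    using ne s by (auto simp: add_eq_0_iff)
  then have inj: "inj (second_difference n (s + \<theta>) (s - \<theta>))"
    using assms(1) by (simp add: power_2PN_def)
  have eq: "?g x = second_difference n (s + \<theta>) (s - \<theta>) (x - s)" for x
    by (simp add: second_difference_def algebra_simps)
  show "inj_on ?g K"
    unfolding eq
  proof (rule inj_onI)
    fix x y
    assume "second_difference n (s + \<theta>) (s - \<theta>) (x - s) = second_difference n (s + \<theta>) (s - \<theta>) (y - s)"
    from injD[OF inj this] show "x = y"
      by simp
  qed
qed

text \<open>Raising to the \<open>Q\<close>-th power fixes \<open>x\<close> and \<open>s\<close> and exchanges \<open>x + \<theta>\<close> with \<open>x - \<theta>\<close>.\<close>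

lemma symmetric_difference_in_K:
  fixes \<theta> :: 'a
  assumes \<theta>: "\<theta> ^ Q = - \<theta>" and "x \<in> K" and "s \<in> K"
  shows "(x + s) ^ n + (x - s) ^ n - (x + \<theta>) ^ n - (x - \<theta>) ^ n \<in> K"
proof -
  have *: "(x + \<theta>) ^ Q = x - \<theta>" "(x - \<theta>) ^ Q = x + \<theta>"
    using assms by (simp_all add: add_power_Q diff_power_Q fixed_field_def)
  have "(z ^ n) ^ Q = (z ^ Q) ^ n" for z :: 'a
    by (simp only: power_mult[symmetric] mult.commute)
  then have "((x + \<theta>) ^ n + (x - \<theta>) ^ n) ^ Q = ((x + \<theta>) ^ Q) ^ n + ((x - \<theta>) ^ Q) ^ n"
    by (simp only: add_power_Q[of "_ ^ n"])
  then have "(x + \<theta>) ^ n + (x - \<theta>) ^ n \<in> K"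
    unfolding * by (simp add: fixed_field_def add.commute)
  then have "(x + s) ^ n + (x - s) ^ n - ((x + \<theta>) ^ n + (x - \<theta>) ^ n) \<in> K"
    using assms by simp
  then show ?thesis
    by (simp add: diff_diff_eq)
qed

lemma sum_symmetric_difference_power:
  fixes \<theta> :: 'a
  assumes "power_2PN n" and "\<theta> \<noteq> 0" and "\<theta> ^ Q = - \<theta>" and "s \<in> K"
    and "0 < m" and "m < Q - 1"
  shows "(\<Sum>x\<in>K. ((x + s) ^ n + (x - s) ^ n - (x + \<theta>) ^ n - (x - \<theta>) ^ n) ^ m) = 0"
  by (rule sum_power_permutation[OF inj_on_symmetric_difference]) (use assms symmetric_difference_in_K in auto)

text \<open>Here \<open>(x + s) ^ n + (x - s) ^ n = 2 * x ^ 3 + 6 * s\<^sup>2 * x\<close>, so the permutation has the form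
  \<open>6 * s\<^sup>2 * x - \<kappa> x\<close> with \<open>\<kappa>\<close> independent of \<open>s\<close>. The sum of its powers with exponent \<open>j + 1\<close> vanishes
  for every \<open>s\<close>; the coefficient of \<open>s ^ (2 * j)\<close> in it is, up to a nonzero factor, the claimed sum.\<close>

lemma sum_cubic_remainder:
  fixes \<theta> :: 'a
  assumes "power_2PN n" and "\<theta> \<noteq> 0" and "\<theta> ^ Q = - \<theta>"
    and cubic: "\<And>x. x \<in> K \<Longrightarrow> x ^ n = x ^ 3"
    and "\<not> p dvd j + 1" and "2 * (j + 1) \<le> Q - 1"
  shows "(\<Sum>x\<in>K. x ^ j * ((x + \<theta>) ^ n + (x - \<theta>) ^ n - 2 * x ^ 3)) = 0"
proof -
  define \<kappa> where "\<kappa> x = (x + \<theta>) ^ n + (x - \<theta>) ^ n - 2 * x ^ 3" for x :: 'a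
  \<comment> \<open>Summation against \<open>s ^ e\<close> extracts the coefficient: among the exponents \<open>e + 2 * l\<close> only \<open>l = j\<close>
    gives a positive multiple of \<open>Q - 1\<close>.\<close>
  define e where "e = Q - 1 - 2 * j"
  have e: "e + 2 * j = Q - 1" "e \<ge> 2"
    using assms(6) by (auto simp: e_def)
  have inner: "(\<Sum>x\<in>K. (6 * s\<^sup>2 * x - \<kappa> x) ^ (j + 1)) = 0" if s: "s \<in> K" for s
  proof -
    have eq: "(x + s) ^ n + (x - s) ^ n - (x + \<theta>) ^ n - (x - \<theta>) ^ n = 6 * s\<^sup>2 * x - \<kappa> x" if "x \<in> K" for x
    proof -
      have "(x + s) ^ n = (x + s) ^ 3" "(x - s) ^ n = (x - s) ^ 3"
        using cubic that s by auto
      then show ?thesis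
        by (simp add: \<kappa>_def power2_eq_square power3_eq_cube algebra_simps)
    qed
    have "(\<Sum>x\<in>K. ((x + s) ^ n + (x - s) ^ n - (x + \<theta>) ^ n - (x - \<theta>) ^ n) ^ (j + 1)) = 0"
      by (rule sum_symmetric_difference_power) (use assms s in auto)
    then show ?thesis
      by (simp only: eq cong: sum.cong)
  qed
  have "0 = (\<Sum>s\<in>K. s ^ e * (\<Sum>x\<in>K. (6 * s\<^sup>2 * x - \<kappa> x) ^ (j + 1)))"
    using inner by simp
  also have "\<dots> = (\<Sum>s\<in>K. \<Sum>x\<in>K. \<Sum>l\<le>j + 1. of_nat (j + 1 choose l) * (6 * x) ^ l * (- \<kappa> x) ^ (j + 1 - l) * s ^ (e + 2 * l))"
    unfolding diff_conv_add_uminus binomial_ring sum_distrib_left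
    by (intro sum.cong refl) (simp add: power_mult_distrib power_add ac_simps flip: power_mult)
  also have "\<dots> = (\<Sum>l\<le>j + 1. \<Sum>x\<in>K. of_nat (j + 1 choose l) * (6 * x) ^ l * (- \<kappa> x) ^ (j + 1 - l) * (\<Sum>s\<in>K. s ^ (e + 2 * l)))"
    unfolding sum_distrib_left by (rule sum_reverse_order)
  also have "\<dots> = (\<Sum>l\<le>j + 1. if l = j then \<Sum>x\<in>K. of_nat (j + 1) * (6 * x) ^ j * \<kappa> x else 0)"
  proof (rule sum.cong)
    fix l
    assume l: "l \<in> {..j + 1}"
    have "0 < e + 2 * l \<and> (Q - 1) dvd (e + 2 * l) \<longleftrightarrow> l = j"
    proof
      assume d: "0 < e + 2 * l \<and> (Q - 1) dvd (e + 2 * l)"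
      have "e + 2 * l < 2 * (Q - 1)"
        using l e Q_ge_5 by auto
      then have "e + 2 * l = Q - 1"
        using d by (intro dvd_less_double_imp_eq) auto
      then show "l = j"
        using e by auto
    qed (use e Q_ge_5 in auto)
    then show "(\<Sum>x\<in>K. of_nat (j + 1 choose l) * (6 * x) ^ l * (- \<kappa> x) ^ (j + 1 - l) * (\<Sum>s\<in>K. s ^ (e + 2 * l))) =
        (if l = j then \<Sum>x\<in>K. of_nat (j + 1) * (6 * x) ^ j * \<kappa> x else 0)"
      unfolding sum_power by simp
  qed simp
  also have "\<dots> = of_nat (j + 1) * 6 ^ j * (\<Sum>x\<in>K. x ^ j * \<kappa> x)"
    by (simp add: sum_distrib_left power_mult_distrib ac_simps del: of_nat_Suc of_nat_add)
  finally show ?thesis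
    using numerals_nonzero assms(5) of_nat_eq_0_iff[of "j + 1"] unfolding \<kappa>_def by simp
qed

end

section \<open>The exponent over the prime field\<close>

context quartic_subfield
begin

text \<open>The second difference with directions \<open>1\<close> and \<open>a\<close> is \<open>\<psi> (x + a) - \<psi> x\<close>, where
  \<open>\<psi> x = (x + 1) ^ r - x ^ r\<close> has degree \<open>N = r - 1\<close>. Hence \<open>\<psi>\<close> is a planar function on the prime field. For
  \<open>N < 2\<close> the second differences are constant, so \<open>N > 2\<close> has to be refuted.

  Let \<open>L\<close> be the largest integer with \<open>L * N \<le> p - 1\<close>. The sum over all \<open>x\<close>, \<open>y\<close> of
  \<open>(y - x) ^ e * (\<psi> y - \<psi> x) ^ (2 * L)\<close> vanishes by Hermite's criterion applied for each difference \<open>y - x\<close>.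
  For \<open>e = 2 * (p - 1 - L * N)\<close> the total degree is exactly \<open>2 * (p - 1)\<close>, so after binomial
  expansion only products with degree \<open>p - 1\<close> in each variable contribute. There is a single one,
  the middle term, and its coefficient is not divisible by \<open>p\<close>.\<close>

lemma exponent_eq_3_over_prime_field:
  assumes "power_2PN n" and Qp: "Q = p"
    and r: "1 \<le> r" "r \<le> p - 1" and pow: "\<And>x. x \<in> K \<Longrightarrow> x ^ n = x ^ r"
  shows "r = 3"
proof (rule ccontr)
  assume "r \<noteq> 3"
  have one: "(1::'a) \<in> K" by simp
  have sd: "second_difference n 1 a x = (x + 1 + a) ^ r - (x + 1) ^ r - (x + a) ^ r + x ^ r"
    if "a \<in> K" "x \<in> K" for a x
    using that one by (simp add: second_difference_def pow)
  have inj: "inj (second_difference n 1 (a::'a))" if "a \<noteq> 0" for a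
    using assms(1) that by (simp add: power_2PN_def)
  consider "r = 1" | "r = 2" | "r \<ge> 4"
    using r \<open>r \<noteq> 3\<close> by linarith
  then show False
  proof cases
    case 1
    have "second_difference n 1 1 (0::'a) = second_difference n 1 1 1"
      by (simp add: sd 1)
    then have "(0::'a) = 1"
      by (rule injD[OF inj[OF one_neq_zero]])
    then show False
      by simp
  next
    case 2
    have "second_difference n 1 1 (0::'a) = second_difference n 1 1 1"
      by (simp add: sd 2)
    then have "(0::'a) = 1"
      by (rule injD[OF inj[OF one_neq_zero]])
    then show False
      by simp
  next
    case 3
    define N where "N = r - 1"
    define L where "L = (p - 1) div N"
    define e where "e = 2 * (p - 1 - L * N)"
    have N: "3 \<le> N" "N \<le> p - 2"
      using 3 r by (auto simp: N_def)
    have "p - 1 = L * N + (p - 1) mod N" "(p - 1) mod N < N"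
      using N by (simp_all add: L_def)
    then have LN: "L * N \<le> p - 1" "p - 1 - L * N < N"
      by linarith+
    have L1: "1 \<le> L"
      using N p_ge_5 by (auto simp: L_def div_greater_zero_iff Suc_le_eq)
    have "3 * L \<le> L * N"
      using N(1) by (simp add: mult.commute)
    then have L3: "3 * L \<le> p - 1"
      using LN(1) by linarith
    have "N \<le> L * N"
      using L1 by simp
    then have e_le: "e \<le> p - 1"
      using LN unfolding e_def by linarith
    define \<psi> :: "'a poly" where "\<psi> = [:1, 1:] ^ r - monom 1 r"
    have poly_psi: "poly \<psi> x = (x + 1) ^ r - x ^ r" for x
      by (simp add: \<psi>_def poly_monom add.commute)
    have deg_le: "degree \<psi> \<le> r"
      unfolding \<psi>_def by (rule degree_diff_le) (simp_all add: degree_linear_power degree_monom_le)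
    have "coeff \<psi> r = 0"
      using coeff_linear_poly_power[of r r "1::'a" 1] by (simp add: \<psi>_def)
    have r0: "of_nat r \<noteq> (0::'a)"
      by (rule of_nat_nonzero) (use r p_ge_5 in auto)
    have coeffN: "coeff \<psi> N = of_nat r"
    proof -
      have "r choose N = r"
        using binomial_symmetric[of N r] 3 by (simp add: N_def)
      then show ?thesis
        using coeff_linear_poly_power[of N r "1::'a" 1] 3 by (simp add: \<psi>_def N_def)
    qed
    then have psi0: "\<psi> \<noteq> 0"
      using r0 by auto
    have degN: "degree \<psi> = N"
    proof (rule antisym)
      have "degree \<psi> \<noteq> r"
        using \<open>coeff \<psi> r = 0\<close> psi0 leading_coeff_neq_0 by metis
      then show "degree \<psi> \<le> N"
        using deg_le by (simp add: N_def)
      show "N \<le> degree \<psi>"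
        using coeffN r0 by (intro le_degree) simp
    qed
    have inner: "(\<Sum>x\<in>K. (poly \<psi> (x + a) - poly \<psi> x) ^ (2 * L)) = 0" if a: "a \<in> K" for a
    proof (cases "a = 0")
      case False
      have eq: "poly \<psi> (x + a) - poly \<psi> x = second_difference n 1 a x" if "x \<in> K" for x
        unfolding sd[OF a that] poly_psi by (simp add: algebra_simps)
      have "(\<Sum>x\<in>K. second_difference n 1 a x ^ (2 * L)) = 0"
      proof (rule sum_power_permutation)
        show "inj_on (second_difference n 1 a) K"
          using inj[OF False] by (rule inj_on_subset) simp
        show "second_difference n 1 a x \<in> K" if "x \<in> K" for x
          using a that by (simp add: second_difference_def)
      qed (use L1 L3 Qp p_ge_5 in auto)
      then show ?thesis
        by (simp only: eq cong: sum.cong)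
    qed (use L1 in \<open>simp add: power_0_left\<close>)
    \<comment> \<open>The sums in one variable into which the expanded double sum factors.\<close>
    define A where "A k i = (\<Sum>x\<in>K. x ^ k * poly \<psi> x ^ i)" for k i
    have A: "A k i = (if k + N * i = p - 1 then - (of_nat r ^ i) else 0)" if "k + N * i \<le> p - 1" for k i
    proof -
      have deg: "degree (monom 1 k * \<psi> ^ i) \<le> k + N * i"
        by (intro order_trans[OF degree_mult_le] add_mono degree_monom_le)
           (simp add: degree_power_eq psi0 degN)
      have "A k i = (\<Sum>x\<in>K. poly (monom 1 k * \<psi> ^ i) x)"
        by (simp add: A_def poly_monom)
      also have "\<dots> = - coeff (monom 1 k * \<psi> ^ i) (p - 1)"
        using sum_poly[of "monom 1 k * \<psi> ^ i"] deg that Qp p_ge_5 by simp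
      also have "\<dots> = (if k + N * i = p - 1 then - (of_nat r ^ i) else 0)"
      proof (cases "k + N * i = p - 1")
        case True
        have "coeff (\<psi> ^ i) (N * i) = of_nat r ^ i"
          using lead_coeff_power[of \<psi> i] degN coeffN psi0 by (simp add: degree_power_eq mult.commute)
        moreover have "p - 1 - k = N * i" "k \<le> p - 1"
          using True by auto
        ultimately show ?thesis
          using True by (simp add: coeff_monom_mult)
      next
        case False
        then show ?thesis
          using deg that by (simp add: coeff_eq_0)
      qed
      finally show ?thesis .
    qed
    have "0 = (\<Sum>a\<in>K. a ^ e * (\<Sum>x\<in>K. (poly \<psi> (x + a) - poly \<psi> x) ^ (2 * L)))"
      using inner by simp
    also have "\<dots> = (\<Sum>x\<in>K. \<Sum>a\<in>K. a ^ e * (poly \<psi> (x + a) - poly \<psi> x) ^ (2 * L))"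
      unfolding sum_distrib_left by (rule sum.swap)
    also have "\<dots> = (\<Sum>x\<in>K. \<Sum>y\<in>K. (y - x) ^ e * (poly \<psi> y - poly \<psi> x) ^ (2 * L))"
    proof (rule sum.cong)
      fix x :: 'a
      assume "x \<in> K"
      then show "(\<Sum>a\<in>K. a ^ e * (poly \<psi> (x + a) - poly \<psi> x) ^ (2 * L)) =
          (\<Sum>y\<in>K. (y - x) ^ e * (poly \<psi> y - poly \<psi> x) ^ (2 * L))"
        by (intro sum.reindex_bij_witness[of _ "\<lambda>y. y - x" "\<lambda>a. x + a"]) auto
    qed simp
    also have "\<dots> = (\<Sum>x\<in>K. \<Sum>y\<in>K. \<Sum>(k, i)\<in>{..e} \<times> {..2 * L}.
        of_nat (e choose k) * of_nat (2 * L choose i) * (- 1) ^ (e - k + (2 * L - i)) *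
        (y ^ k * poly \<psi> y ^ i) * (x ^ (e - k) * poly \<psi> x ^ (2 * L - i)))"
    proof (intro sum.cong refl)
      fix x y :: 'a
      have expand: "(u - v) ^ m = (\<Sum>i\<le>m. of_nat (m choose i) * (- 1) ^ (m - i) * (u ^ i * v ^ (m - i)))"
        for u v :: 'a and m
        unfolding diff_conv_add_uminus binomial_ring power_minus[of v] by (simp only: ac_simps)
      show "(y - x) ^ e * (poly \<psi> y - poly \<psi> x) ^ (2 * L) = (\<Sum>(k, i)\<in>{..e} \<times> {..2 * L}.
        of_nat (e choose k) * of_nat (2 * L choose i) * (- 1) ^ (e - k + (2 * L - i)) *
        (y ^ k * poly \<psi> y ^ i) * (x ^ (e - k) * poly \<psi> x ^ (2 * L - i)))"
        unfolding expand sum_product sum.cartesian_product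
        by (intro sum.cong refl) (simp add: case_prod_unfold power_add ac_simps)
    qed
    also have "\<dots> = (\<Sum>(k, i)\<in>{..e} \<times> {..2 * L}. \<Sum>y\<in>K. \<Sum>x\<in>K.
        of_nat (e choose k) * of_nat (2 * L choose i) * (- 1) ^ (e - k + (2 * L - i)) *
        (y ^ k * poly \<psi> y ^ i) * (x ^ (e - k) * poly \<psi> x ^ (2 * L - i)))"
      unfolding case_prod_unfold by (rule sum_reverse_order)
    also have "\<dots> = (\<Sum>(k, i)\<in>{..e} \<times> {..2 * L}.
        of_nat (e choose k) * of_nat (2 * L choose i) * (- 1) ^ (e - k + (2 * L - i)) *
        (A k i * A (e - k) (2 * L - i)))"
      unfolding A_def sum_product
      unfolding sum_distrib_left by (simp add: mult.assoc)
    also have "\<dots> = (\<Sum>ki\<in>{..e} \<times> {..2 * L}. if ki = (p - 1 - L * N, L) then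
        of_nat (e choose (p - 1 - L * N)) * of_nat (2 * L choose L) * (- 1) ^ (p - 1 - L * N + L) *
        of_nat r ^ (2 * L) else 0)"
    proof (rule sum.cong)
      fix ki
      assume "ki \<in> {..e} \<times> {..2 * L}"
      then obtain k i where ki: "ki = (k, i)" and k: "k \<le> e" and i: "i \<le> 2 * L"
        by auto
      define k' i' where "k' = e - k" and "i' = 2 * L - i"
      have "N * i + N * i' = 2 * (L * N)"
        using i by (simp add: i'_def flip: distrib_left)
      then have tot: "(k + N * i) + (k' + N * i') = 2 * (p - 1)"
        using k LN(1) by (simp add: k'_def e_def)
      \<comment> \<open>If both degrees are \<open>p - 1\<close>, then \<open>i\<close> and \<open>2 * L - i\<close> are both at most \<open>L\<close>.\<close>
      have "A k i * A k' i' = (if (k, i) = (p - 1 - L * N, L) then of_nat r ^ (2 * L) else 0)"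
      proof (cases "k + N * i = p - 1")
        case True
        then have T': "k' + N * i' = p - 1"
          using tot by simp
        have "i \<le> L"
          using True N unfolding L_def by (simp add: less_eq_div_iff_mult_less_eq mult.commute)
        moreover have "i' \<le> L"
          using T' N unfolding L_def by (simp add: less_eq_div_iff_mult_less_eq mult.commute)
        ultimately have "i = L" "i' = L"
          using i by (auto simp: i'_def)
        moreover have "k = p - 1 - L * N"
          using True \<open>i = L\<close> by (simp add: mult.commute)
        ultimately show ?thesis
          using A[of k i] A[of k' i'] True T' by (simp add: mult_2 power_add)
      next
        case False
        then have "k + N * i < p - 1 \<or> k' + N * i' < p - 1"
          using tot by linarith
        then have "A k i * A k' i' = 0"
          using A[of k i] A[of k' i'] by auto
        moreover have "(k, i) \<noteq> (p - 1 - L * N, L)"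
          using False LN(1) by (auto simp: mult.commute)
        ultimately show ?thesis
          by (simp only: if_False)
      qed
      then show "(case ki of (k, i) \<Rightarrow> of_nat (e choose k) * of_nat (2 * L choose i) * (- 1) ^ (e - k + (2 * L - i)) *
        (A k i * A (e - k) (2 * L - i))) = (if ki = (p - 1 - L * N, L) then
        of_nat (e choose (p - 1 - L * N)) * of_nat (2 * L choose L) * (- 1) ^ (p - 1 - L * N + L) *
        of_nat r ^ (2 * L) else 0)"
        unfolding ki k'_def i'_def by (auto simp: e_def mult_2)
    qed simp
    also have "\<dots> = of_nat (e choose (p - 1 - L * N)) * of_nat (2 * L choose L) * (- 1) ^ (p - 1 - L * N + L) *
        of_nat r ^ (2 * L)"
      by (subst sum.delta) (auto simp: e_def)
    finally have "of_nat (e choose (p - 1 - L * N)) * of_nat (2 * L choose L) * of_nat r ^ (2 * L) = (0::'a)"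
      by (auto simp: power_add)
    moreover have "of_nat (e choose (p - 1 - L * N)) \<noteq> (0::'a)"
      by (rule of_nat_binomial_nonzero) (use e_le p_ge_5 in \<open>auto simp: e_def\<close>)
    moreover have "of_nat (2 * L choose L) \<noteq> (0::'a)"
      by (rule of_nat_binomial_nonzero) (use L3 L1 in auto)
    ultimately show False
      using r0 by simp
  qed
qed

end

section \<open>Digit sums over the field with p squared elements\<close>

context quartic_field
begin

text \<open>Two digits with sum \<open>p + 2\<close> both lie between \<open>3\<close> and \<open>p - 1\<close>.\<close>

lemma coeff_balanced_poly_minus_4_nonzero:
  fixes \<theta> :: 'a
  assumes "\<theta> \<noteq> 0" and "u < p" and "v < p" and "u + v = p + 2"
  shows "coeff (balanced_poly \<theta> u v) (p - 2) \<noteq> 0"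
proof -
  define \<delta> :: 'a where "\<delta> = of_nat u - of_nat v"
  have w: "of_nat (u + v) = (2::'a)"
    unfolding assms(4) using of_nat_eq_0_iff[of p] by simp
  have v: "of_nat v = 2 - (of_nat u :: 'a)"
    using w by (simp add: algebra_simps)
  have "24 * coeff (balanced_poly \<theta> u v) (u + v - 4) = \<theta> ^ 4 * \<delta>\<^sup>2 * (\<delta>\<^sup>2 - 4)"
    unfolding \<delta>_def by (rule coeff_balanced_poly_minus_4) (use assms w in auto)
  moreover have "\<delta> = 2 * of_nat (u - 1)" and "\<delta>\<^sup>2 - 4 = 4 * of_nat u * of_nat (u - 2)"
    using assms by (auto simp: \<delta>_def v of_nat_diff power2_eq_square algebra_simps)
  moreover have "of_nat (u - 1) \<noteq> (0::'a)" "of_nat u \<noteq> (0::'a)" "of_nat (u - 2) \<noteq> (0::'a)"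
    by (rule of_nat_nonzero; use assms in simp)+
  moreover have "u + v - 4 = p - 2"
    using assms by simp
  moreover have "(16::'a) \<noteq> 0"
    proof -
    have "(16::'a) = 4 * 4"
      by simp
    then show ?thesis
      using numerals_nonzero(3) by (metis mult_eq_0_iff)
  qed
  ultimately show ?thesis
    using assms(1) numerals_nonzero by auto
qed

end

context quartic_subfield
begin

text \<open>The condition of \<open>sum_cubic_remainder\<close> with \<open>j = 1\<close> is that the coefficient of \<open>x ^ (p - 2)\<close> in
  \<open>(x + \<theta>) ^ u * (x - \<theta>) ^ v\<close> vanishes. It is the fourth coefficient below the leading one.\<close>

lemma digit_sum_p_plus_2_contradiction:
  fixes \<theta> :: 'a
  assumes "power_2PN n" and "Q = p" and "\<theta> \<noteq> 0" and \<theta>: "\<theta> ^ Q = - \<theta>"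
    and cubic: "\<And>x. x \<in> K \<Longrightarrow> x ^ n = x ^ 3"
    and uv: "u < p" "v < p" "u + v = p + 2"
    and balanced: "\<And>x. x \<in> K \<Longrightarrow> (x + \<theta>) ^ n = (x + \<theta>) ^ u * (x - \<theta>) ^ v"
      "\<And>x. x \<in> K \<Longrightarrow> (x - \<theta>) ^ n = (x - \<theta>) ^ u * (x + \<theta>) ^ v"
  shows False
proof -
  \<comment> \<open>On the prime field \<open>x ^ 3 = x ^ (p + 2)\<close>. In this form the leading terms cancel, which keeps the
    degree of \<open>x * P\<close> below \<open>2 * (p - 1)\<close> even for \<open>p = 5\<close>.\<close>
  define P where "P = balanced_poly \<theta> u v + balanced_poly (- \<theta>) u v - monom 2 (p + 2)"
  have "degree P \<le> p + 2"
    unfolding P_def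
    by (intro degree_diff_le degree_add_le) (simp_all add: degree_balanced_poly uv degree_monom_le)
  moreover have "coeff P (p + 2) = 0"
    using coeff_balanced_poly_top[of \<theta> u v] coeff_balanced_poly_top[of "- \<theta>" u v] uv by (simp add: P_def)
  ultimately have degP: "degree P \<le> p + 1"
    using leading_coeff_0_iff[of P] by (cases "degree P = p + 2") auto
  have "(\<Sum>x\<in>K. x ^ 1 * ((x + \<theta>) ^ n + (x - \<theta>) ^ n - 2 * x ^ 3)) = 0"
    by (rule sum_cubic_remainder) (use assms p_ge_5 in \<open>auto dest: dvd_imp_le\<close>)
  also have "(\<Sum>x\<in>K. x ^ 1 * ((x + \<theta>) ^ n + (x - \<theta>) ^ n - 2 * x ^ 3)) = (\<Sum>x\<in>K. poly (pCons 0 P) x)"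
  proof (rule sum.cong)
    fix x
    assume x: "x \<in> K"
    then have "x ^ (p + 2) = x ^ 3"
      using \<open>Q = p\<close> by (simp add: fixed_field_def power_add power2_eq_square power3_eq_cube)
    then show "x ^ 1 * ((x + \<theta>) ^ n + (x - \<theta>) ^ n - 2 * x ^ 3) = poly (pCons 0 P) x"
      using x by (simp add: P_def poly_balanced_poly poly_monom balanced)
  qed simp
  also have "\<dots> = - coeff (pCons 0 P) (Q - 1)"
    by (rule sum_poly) (use degP p_ge_5 \<open>Q = p\<close> degree_pCons_le[of 0 P] in linarith)
  also have "coeff (pCons 0 P) (Q - 1) = coeff P (p - 2)"
  proof -
    have "Q - 1 = Suc (p - 2)"
      using p_ge_5 \<open>Q = p\<close> by simp
    then show ?thesis
      by (simp only: coeff_pCons_Suc)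
  qed
  also have "\<dots> = coeff (balanced_poly \<theta> u v) (p - 2) + coeff (balanced_poly (- \<theta>) u v) (p - 2)"
    by (simp add: P_def)
  finally have s: "coeff (balanced_poly \<theta> u v) (p - 2) + coeff (balanced_poly (- \<theta>) u v) (p - 2) = 0"
    by (simp only: neg_equal_0_iff_equal)
  have w: "of_nat (u + v) = (2::'a)"
    unfolding uv using of_nat_eq_0_iff[of p] by simp
  have e: "u + v - 4 = p - 2" "4 \<le> u + v"
    using uv p_ge_5 by auto
  have "24 * coeff (balanced_poly \<theta> u v) (p - 2) = 24 * coeff (balanced_poly (- \<theta>) u v) (p - 2)"
    using coeff_balanced_poly_minus_4[OF e(2) w, of \<theta>] coeff_balanced_poly_minus_4[OF e(2) w, of "- \<theta>"]
    unfolding e by simp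
  moreover have "(24::'a) \<noteq> 0"
  proof -
    have "(24::'a) = 4 * 6"
      by simp
    then show ?thesis
      using numerals_nonzero(3,4) by (metis mult_eq_0_iff)
  qed
  ultimately show False
    using s coeff_balanced_poly_minus_4_nonzero[OF assms(3) uv] numerals_nonzero(1)
    by (metis mult_2 mult_cancel_left mult_eq_0_iff)
qed

end

section \<open>Exponents congruent to 3\<close>

context quartic_subfield
begin

text \<open>On the field with \<open>p\<^sup>2\<close> elements, \<open>x\<close> and \<open>x ^ p\<close> behave like independent variables as long as no exponent
  is too large: among the exponents \<open>a + p * b\<close> within the given bounds, only \<open>a = b = p - 1\<close> is a positive
  multiple of \<open>p\<^sup>2 - 1\<close>. The bounds are asymmetric so as to admit all digit patterns that
  occur below.\<close>

lemma sum_two_variables: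
  assumes "Q = p\<^sup>2" and "\<alpha> + degree B \<le> 2 * p - 2" and "\<beta> + degree C \<le> p + 1"
    and "\<alpha> \<le> p - 1" and "\<beta> \<le> p - 1"
  shows "(\<Sum>x\<in>K. x ^ \<alpha> * (x ^ p) ^ \<beta> * (poly B x * poly C (x ^ p))) =
    - (coeff B (p - 1 - \<alpha>) * coeff C (p - 1 - \<beta>))"
proof -
  have "(\<Sum>x\<in>K. x ^ \<alpha> * (x ^ p) ^ \<beta> * (poly B x * poly C (x ^ p))) =
    (\<Sum>x\<in>K. \<Sum>(i, j)\<in>{..degree B} \<times> {..degree C}. coeff B i * coeff C j * x ^ (\<alpha> + i + p * (\<beta> + j)))"
  proof (rule sum.cong)
    fix x :: 'a
    show "x ^ \<alpha> * (x ^ p) ^ \<beta> * (poly B x * poly C (x ^ p)) =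
      (\<Sum>(i, j)\<in>{..degree B} \<times> {..degree C}. coeff B i * coeff C j * x ^ (\<alpha> + i + p * (\<beta> + j)))"
      unfolding poly_altdef sum_product sum.cartesian_product
      unfolding sum_distrib_left
      by (intro sum.cong refl) (simp add: case_prod_unfold power_add distrib_left ac_simps flip: power_mult)
  qed simp
  also have "\<dots> = (\<Sum>(i, j)\<in>{..degree B} \<times> {..degree C}.
      coeff B i * coeff C j * (\<Sum>x\<in>K. x ^ (\<alpha> + i + p * (\<beta> + j))))"
    unfolding sum_distrib_left case_prod_unfold by (rule sum.swap)
  also have "\<dots> = (\<Sum>ij\<in>{..degree B} \<times> {..degree C}. if ij = (p - 1 - \<alpha>, p - 1 - \<beta>)
      then - (coeff B (p - 1 - \<alpha>) * coeff C (p - 1 - \<beta>)) else 0)"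
  proof (rule sum.cong)
    fix ij
    assume "ij \<in> {..degree B} \<times> {..degree C}"
    then obtain i j where ij: "ij = (i, j)" "i \<le> degree B" "j \<le> degree C"
      by auto
    define a b where "a = \<alpha> + i" and "b = \<beta> + j"
    have ab: "a \<le> 2 * p - 2" "b \<le> p + 1"
      using assms(2,3) ij by (auto simp: a_def b_def)
    have sq: "p\<^sup>2 = p * p" "5 * p \<le> p * p"
      using p_ge_5 by (auto simp: power2_eq_square)
    have "0 < a + p * b \<and> (Q - 1) dvd (a + p * b) \<longleftrightarrow> (a, b) = (p - 1, p - 1)"
    proof
      assume d: "0 < a + p * b \<and> (Q - 1) dvd (a + p * b)"
      have "p * b \<le> p * (p + 1)"
        using ab by (intro mult_left_mono) auto
      then have "a + p * b < 2 * (p * p - 1)"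
        using ab(1) sq(2) p_ge_5 unfolding distrib_left mult_1_right by linarith
      then have "a + p * b = Q - 1"
        using d assms(1) sq by (intro dvd_less_double_imp_eq) auto
      then have eq: "a + 1 + p * b = p * p"
        using assms(1) sq p_ge_5 by (simp add: Suc_diff_Suc)
      then have "p dvd a + 1"
        by (metis dvd_add_left_iff dvd_triv_left)
      moreover have "a + 1 < 2 * p"
        using ab p_ge_5 by linarith
      ultimately have "a + 1 = p"
        by (intro dvd_less_double_imp_eq) auto
      moreover from this have "p * (b + 1) = p * p"
        using eq by simp
      then have "b + 1 = p"
        using p_ge_5 by (simp only: mult_cancel1) auto
      ultimately show "(a, b) = (p - 1, p - 1)"
        by auto
    next
      assume "(a, b) = (p - 1, p - 1)"
      moreover have "p - 1 + p * (p - 1) = p * p - 1"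
        using sq(2) p_ge_5 unfolding diff_mult_distrib2 by linarith
      moreover have "0 < Q - 1"
        using Q_ge_5 by simp
      ultimately have "a + p * b = Q - 1" "0 < Q - 1"
        using assms(1) sq(1) by simp_all
      then show "0 < a + p * b \<and> (Q - 1) dvd (a + p * b)"
        by simp
    qed
    moreover have "(a, b) = (p - 1, p - 1) \<longleftrightarrow> ij = (p - 1 - \<alpha>, p - 1 - \<beta>)"
      using assms(4,5) by (auto simp: ij a_def b_def)
    ultimately have "(\<Sum>x\<in>K. x ^ (\<alpha> + i + p * (\<beta> + j))) =
        (if ij = (p - 1 - \<alpha>, p - 1 - \<beta>) then - 1 else 0)"
      unfolding sum_power a_def[symmetric] b_def[symmetric] by (simp only:)
    then show "(case ij of (i, j) \<Rightarrow> coeff B i * coeff C j * (\<Sum>x\<in>K. x ^ (\<alpha> + i + p * (\<beta> + j)))) =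
      (if ij = (p - 1 - \<alpha>, p - 1 - \<beta>) then - (coeff B (p - 1 - \<alpha>) * coeff C (p - 1 - \<beta>)) else 0)"
      using ij(1) by simp
  qed simp
  also have "\<dots> = - (coeff B (p - 1 - \<alpha>) * coeff C (p - 1 - \<beta>))"
    by (subst sum.delta) (auto simp: coeff_eq_0)
  finally show ?thesis .
qed

end

context quartic_field
begin

lemma power_digits:
  "(x::'a) ^ (n0 + p * n1 + p\<^sup>2 * n2 + p ^ 3 * n3) = x ^ n0 * (x ^ p) ^ n1 * (x ^ p\<^sup>2) ^ n2 * (x ^ p ^ 3) ^ n3"
  by (simp add: power_add power_mult)

text \<open>Twice the coefficient is \<open>4 * \<tau>\<^sup>2 * u\<^sup>2\<close> if \<open>u + v = p\<close>, and \<open>4 * \<tau>\<^sup>2 * u * (u - 1)\<close> if \<open>u + v = p + 1\<close>. In the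
  second case neither \<open>u\<close> nor \<open>v\<close> can be \<open>0\<close> or \<open>1\<close>.\<close>

lemma coeff_balanced_poly_minus_2_nonzero:
  fixes \<tau> :: 'a
  assumes "\<tau> \<noteq> 0" and "u < p" and "v < p" and "u + v = p \<or> u + v = p + 1"
  shows "coeff (balanced_poly \<tau> u v) (u + v - 2) \<noteq> 0"
proof -
  have *: "2 * coeff (balanced_poly \<tau> u v) (u + v - 2) = \<tau>\<^sup>2 * ((of_nat u - of_nat v)\<^sup>2 - of_nat (u + v))"
    by (rule coeff_balanced_poly_minus_2) (use assms p_ge_5 in auto)
  have p0: "of_nat p = (0::'a)"
    using of_nat_eq_0_iff[of p] by simp
  have u: "of_nat u \<noteq> (0::'a)"
    by (rule of_nat_nonzero) (use assms in auto)
  have "(of_nat u - of_nat v)\<^sup>2 - of_nat (u + v) \<noteq> (0::'a)"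
    using assms(4)
  proof
    assume w: "u + v = p"
    then have "of_nat u + of_nat v = (0::'a)"
      using p0 by (metis of_nat_add)
    then have "of_nat v = - (of_nat u :: 'a)"
      by (simp add: eq_neg_iff_add_eq_0 add.commute)
    then have "(of_nat u - of_nat v)\<^sup>2 - of_nat (u + v) = (4 * (of_nat u)\<^sup>2 :: 'a)"
      unfolding w p0 by (simp add: power2_eq_square)
    then show ?thesis
      using u numerals_nonzero(3) by simp
  next
    assume w: "u + v = p + 1"
    have u1: "of_nat (u - 1) \<noteq> (0::'a)"
      by (rule of_nat_nonzero) (use assms w in auto)
    have uw: "of_nat (u + v) = (1::'a)"
      unfolding w using p0 by simp
    then have v: "of_nat v = 1 - (of_nat u :: 'a)"
      by (simp add: algebra_simps)
    have "(of_nat u - of_nat v)\<^sup>2 - of_nat (u + v) = (4 * of_nat u * of_nat (u - 1) :: 'a)"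
      unfolding uw v using assms w by (simp add: power2_eq_square of_nat_diff algebra_simps)
    then show ?thesis
      using u u1 numerals_nonzero(3) by simp
  qed
  then show ?thesis
    using * assms(1) by auto
qed

end

locale quadratic_subfield = quartic_subfield p F Q for p and F :: "'a::{finite, field} itself" and Q +
  fixes \<theta> :: 'a
  assumes Q_eq: "Q = p\<^sup>2" and \<theta>_nonzero: "\<theta> \<noteq> 0" and \<theta>_power: "\<theta> ^ Q = - \<theta>"
begin

lemma K_power_p_p: "x \<in> K \<Longrightarrow> (x ^ p) ^ p = x"
  by (simp add: fixed_field_def Q_eq power2_eq_square flip: power_mult)

lemma p_power_minus: "(- x :: 'a) ^ p = - (x ^ p)"
  and p_power_add: "(x + y :: 'a) ^ p = x ^ p + y ^ p"
  and p_power_diff: "(x - y :: 'a) ^ p = x ^ p - y ^ p"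
  using frobenius_minus[of x 1] frobenius_add[of x y 1] frobenius_diff[of x y 1] by simp_all

text \<open>The powers \<open>p\<^sup>2\<close> and \<open>p ^ 3\<close> of \<open>x + \<theta>\<close> are \<open>x - \<theta>\<close> and \<open>x ^ p - \<theta> ^ p\<close>. So the digits at even positions go with
  \<open>x\<close> and those at odd positions with \<open>x ^ p\<close>.\<close>

lemma power_digits_split:
  fixes n0 n1 n2 n3 :: nat
  defines "n \<equiv> n0 + p * n1 + p\<^sup>2 * n2 + p ^ 3 * n3"
  assumes "x \<in> K"
  shows "(x + \<theta>) ^ n = poly (balanced_poly \<theta> n0 n2) x * poly (balanced_poly (\<theta> ^ p) n1 n3) (x ^ p)"
    and "(x - \<theta>) ^ n = poly (balanced_poly (- \<theta>) n0 n2) x * poly (balanced_poly (- (\<theta> ^ p)) n1 n3) (x ^ p)"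
proof -
  have e: "p ^ 3 = p\<^sup>2 * p"
    by (simp add: power2_eq_square power3_eq_cube)
  have digits: "z ^ n = z ^ n0 * (z ^ p) ^ n1 * (z ^ p\<^sup>2) ^ n2 * ((z ^ p\<^sup>2) ^ p) ^ n3" for z :: 'a
    using power_digits[of z n0 n1 n2 n3] unfolding n_def by (simp only: e power_mult)
  have "(x + \<theta>) ^ p\<^sup>2 = x - \<theta>" "(x - \<theta>) ^ p\<^sup>2 = x + \<theta>"
    using assms(2) \<theta>_power unfolding fixed_field_def Q_eq[symmetric] by (simp_all add: add_power_Q diff_power_Q)
  then show "(x + \<theta>) ^ n = poly (balanced_poly \<theta> n0 n2) x * poly (balanced_poly (\<theta> ^ p) n1 n3) (x ^ p)"
    and "(x - \<theta>) ^ n = poly (balanced_poly (- \<theta>) n0 n2) x * poly (balanced_poly (- (\<theta> ^ p)) n1 n3) (x ^ p)"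
    unfolding digits poly_balanced_poly by (simp_all add: p_power_add p_power_diff ac_simps)
qed

text \<open>The parity condition makes the contributions of \<open>\<theta>\<close> and of \<open>- \<theta>\<close> equal; otherwise they cancel.\<close>

lemma sum_conjugate_pair:
  assumes "n = n0 + p * n1 + p\<^sup>2 * n2 + p ^ 3 * n3"
    and "\<alpha> + (n0 + n2) \<le> 2 * p - 2" and "\<beta> + (n1 + n3) \<le> p + 1"
    and "\<alpha> \<le> p - 1" and "\<beta> \<le> p - 1" and "even (n0 + n1 + n2 + n3 + \<alpha> + \<beta>)"
  shows "(\<Sum>x\<in>K. x ^ (\<alpha> + p * \<beta>) * ((x + \<theta>) ^ n + (x - \<theta>) ^ n)) =
    - 2 * (coeff (balanced_poly \<theta> n0 n2) (p - 1 - \<alpha>) * coeff (balanced_poly (\<theta> ^ p) n1 n3) (p - 1 - \<beta>))"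
proof -
  let ?b = "\<lambda>\<theta>. coeff (balanced_poly \<theta> n0 n2) (p - 1 - \<alpha>)"
  let ?c = "\<lambda>\<tau>. coeff (balanced_poly \<tau> n1 n3) (p - 1 - \<beta>)"
  have sum: "(\<Sum>x\<in>K. x ^ \<alpha> * (x ^ p) ^ \<beta> * (poly (balanced_poly \<mu> n0 n2) x * poly (balanced_poly \<tau> n1 n3) (x ^ p)))
      = - (?b \<mu> * ?c \<tau>)" for \<mu> \<tau> :: 'a
    by (rule sum_two_variables) (use assms Q_eq in \<open>auto simp: degree_balanced_poly\<close>)
  have "(\<Sum>x\<in>K. x ^ (\<alpha> + p * \<beta>) * ((x + \<theta>) ^ n + (x - \<theta>) ^ n)) =
      - (?b \<theta> * ?c (\<theta> ^ p)) + - (?b (- \<theta>) * ?c (- (\<theta> ^ p)))"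
    unfolding sum[symmetric] sum.distrib[symmetric] assms(1)
    by (rule sum.cong, simp, simp only: power_digits_split distrib_left, simp only: power_add power_mult)
  moreover have "?b (- \<theta>) * ?c (- (\<theta> ^ p)) = ?b \<theta> * ?c (\<theta> ^ p)"
  proof -
    have "even (n0 + n2 + (p - 1 - \<alpha>) + (n1 + n3 + (p - 1 - \<beta>)))"
    proof -
      have "n0 + n2 + (p - 1 - \<alpha>) + (n1 + n3 + (p - 1 - \<beta>)) + 2 * (\<alpha> + \<beta>) =
          (n0 + n1 + n2 + n3 + \<alpha> + \<beta>) + 2 * (p - 1)"
        using assms(4,5) by simp
      then show ?thesis
        using assms(6) by (metis dvd_add_left_iff dvd_triv_left)
    qed
    then have "(- 1) ^ (n0 + n2 + (p - 1 - \<alpha>)) * (- 1) ^ (n1 + n3 + (p - 1 - \<beta>)) = (1::'a)"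
      by (simp flip: power_add)
    then show ?thesis
      unfolding coeff_balanced_poly_uminus by (simp add: mult.assoc mult.left_commute)
  qed
  ultimately show ?thesis
    by simp
qed

text \<open>The sums \<open>(n0 + n2, n1 + n3)\<close> are \<open>(2, p)\<close> or \<open>(p + 2, p - 1)\<close>. The moments with \<open>j = 2 * p - 3\<close> and
  \<open>j = 1\<close>, respectively, pick out a product of two coefficients of which one is the leading one
  and the other one is known not to vanish.\<close>

lemma cubic_carry_contradiction:
  assumes "power_2PN n" and n: "n = n0 + p * n1 + p\<^sup>2 * n2 + p ^ 3 * n3"
    and digits: "n0 < p" "n1 < p" "n2 < p" "n3 < p"
    and cubic: "\<And>x. x \<in> K \<Longrightarrow> x ^ n = x ^ 3"
    and sum: "n0 + n2 + p * (n1 + n3) = p\<^sup>2 + 2"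
  shows False
proof -
  have sq: "p\<^sup>2 = p * p" "5 * p \<le> p * p"
    using p_ge_5 by (auto simp: power2_eq_square)
  have p25: "25 \<le> p\<^sup>2"
    using sq p_ge_5 by linarith
  have vanish: "(\<Sum>x\<in>K. x ^ j * ((x + \<theta>) ^ n + (x - \<theta>) ^ n)) = 0"
    if j: "\<not> p dvd j + 1" "2 * (j + 1) \<le> p\<^sup>2 - 1" for j
  proof -
    have "(\<Sum>x\<in>K. x ^ j * ((x + \<theta>) ^ n + (x - \<theta>) ^ n - 2 * x ^ 3)) = 0"
      by (rule sum_cubic_remainder) (use assms(1) cubic j Q_eq \<theta>_nonzero \<theta>_power in auto)
    moreover have "(\<Sum>x\<in>K. x ^ (j + 3)) = 0"
    proof -
      have "j + 3 < Q - 1"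
      proof -
        have "2 * (j + 1) \<le> P - 1 \<Longrightarrow> 25 \<le> P \<Longrightarrow> j + 3 < P - 1" for P
          by presburger
        then show ?thesis
          using j(2) p25 unfolding Q_eq by blast
      qed
      then show ?thesis
        unfolding sum_power by (auto dest: dvd_imp_le)
    qed
    moreover have "(\<Sum>x\<in>K. x ^ j * ((x + \<theta>) ^ n + (x - \<theta>) ^ n)) =
        (\<Sum>x\<in>K. x ^ j * ((x + \<theta>) ^ n + (x - \<theta>) ^ n - 2 * x ^ 3)) + 2 * (\<Sum>x\<in>K. x ^ (j + 3))"
      unfolding sum_distrib_left sum.distrib[symmetric]
      by (rule sum.cong) (simp_all add: power_add algebra_simps)
    ultimately show ?thesis
      by simp
  qed
  have \<tau>: "\<theta> ^ p \<noteq> 0"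
    using \<theta>_nonzero by simp
  have cases: "(n0 + n2 = 2 \<and> n1 + n3 = p) \<or> (n0 + n2 = p + 2 \<and> n1 + n3 = p - 1)"
  proof -
    have lt: "n0 + n2 \<le> 2 * p - 2"
      using digits by linarith
    consider "n1 + n3 \<le> p - 2" | "n1 + n3 = p - 1" | "n1 + n3 = p" | "n1 + n3 \<ge> p + 1"
      by linarith
    then show ?thesis
    proof cases
      case 1
      then have "p * (n1 + n3) \<le> p * (p - 2)"
        by simp
      moreover have "p * (p - 2) + 2 * p = p * p"
        using sq p_ge_5 unfolding diff_mult_distrib2 by linarith
      ultimately show ?thesis
        using sum lt sq(1) p_ge_5 by linarith
    next
      case 2
      then have "n0 + n2 + p * (p - 1) = p\<^sup>2 + 2"
        using sum by simp
      moreover have "p * (p - 1) + p = p * p"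
        using sq p_ge_5 unfolding diff_mult_distrib2 by linarith
      ultimately show ?thesis
        using 2 sq(1) by linarith
    next
      case 3
      then show ?thesis
        using sum sq by simp
    next
      case 4
      then have "p * (p + 1) \<le> p * (n1 + n3)"
        by (rule mult_le_mono2)
      then show ?thesis
        using sum sq p_ge_5 unfolding distrib_left[of p p 1] mult_1_right by linarith
    qed
  qed
  then show False
  proof
    assume A: "n0 + n2 = 2 \<and> n1 + n3 = p"
    have "(\<Sum>x\<in>K. x ^ (p - 3 + p * 1) * ((x + \<theta>) ^ n + (x - \<theta>) ^ n)) =
        - 2 * (coeff (balanced_poly \<theta> n0 n2) (p - 1 - (p - 3)) * coeff (balanced_poly (\<theta> ^ p) n1 n3) (p - 1 - 1))"
    proof (rule sum_conjugate_pair[OF n])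
      have "n0 + n1 + n2 + n3 + (p - 3) + 1 = 2 * p"
        using A p_ge_5 by linarith
      then show "even (n0 + n1 + n2 + n3 + (p - 3) + 1)"
        by simp
    qed (use A p_ge_5 in auto)
    also have "p - 3 + p * 1 = 2 * p - 3"
      using p_ge_5 by simp
    also have "(\<Sum>x\<in>K. x ^ (2 * p - 3) * ((x + \<theta>) ^ n + (x - \<theta>) ^ n)) = 0"
    proof (rule vanish)
      show "\<not> p dvd 2 * p - 3 + 1"
      proof
        assume "p dvd 2 * p - 3 + 1"
        moreover have "2 * p - 3 + 1 + 2 = p * 2"
          using p_ge_5 by simp
        then have "p dvd 2 * p - 3 + 1 + 2"
          by (simp only: dvd_triv_left)
        ultimately have "p dvd 2"
          by (simp only: dvd_add_right_iff)
        then show False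
          using dvd_imp_le[of p 2] p_ge_5 by simp
      qed
      show "2 * (2 * p - 3 + 1) \<le> p\<^sup>2 - 1"
      proof -
        have "5 * p \<le> R \<Longrightarrow> 2 * (2 * p - 3 + 1) \<le> R - 1" for R
          using p_ge_5 by presburger
        then show ?thesis
          using sq by simp
      qed
    qed
    finally have "coeff (balanced_poly \<theta> n0 n2) (p - 1 - (p - 3)) * coeff (balanced_poly (\<theta> ^ p) n1 n3) (p - 1 - 1) = 0"
      using numerals_nonzero(1) by simp
    moreover have "p - 1 - (p - 3) = n0 + n2" "p - 1 - 1 = n1 + n3 - 2"
      using A p_ge_5 by linarith+
    ultimately have "coeff (balanced_poly (\<theta> ^ p) n1 n3) (n1 + n3 - 2) = 0"
      by (simp only: coeff_balanced_poly_top mult_1_left)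
    moreover have "coeff (balanced_poly (\<theta> ^ p) n1 n3) (n1 + n3 - 2) \<noteq> 0"
      by (rule coeff_balanced_poly_minus_2_nonzero[OF \<tau> digits(2,4)]) (simp add: A)
    ultimately show False
      by simp
  next
    assume A: "n0 + n2 = p + 2 \<and> n1 + n3 = p - 1"
    have "(\<Sum>x\<in>K. x ^ (1 + p * 0) * ((x + \<theta>) ^ n + (x - \<theta>) ^ n)) =
        - 2 * (coeff (balanced_poly \<theta> n0 n2) (p - 1 - 1) * coeff (balanced_poly (\<theta> ^ p) n1 n3) (p - 1 - 0))"
    proof (rule sum_conjugate_pair[OF n])
      have "n0 + n1 + n2 + n3 + 1 + 0 = 2 * (p + 1)"
        using A p_ge_5 by presburger
      then show "even (n0 + n1 + n2 + n3 + 1 + 0)"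
        by simp
    qed (use A p_ge_5 in auto)
    also have "(\<Sum>x\<in>K. x ^ (1 + p * 0) * ((x + \<theta>) ^ n + (x - \<theta>) ^ n)) = 0"
    proof (rule vanish)
      show "\<not> p dvd 1 + p * 0 + 1"
        using p_ge_5 by (auto dest: dvd_imp_le)
      show "2 * (1 + p * 0 + 1) \<le> p\<^sup>2 - 1"
        using p25 by simp
    qed
    finally have "coeff (balanced_poly \<theta> n0 n2) (p - 1 - 1) * coeff (balanced_poly (\<theta> ^ p) n1 n3) (p - 1 - 0) = 0"
      using numerals_nonzero(1) by simp
    moreover have "p - 1 - 0 = n1 + n3" "p - 1 - 1 = p - 2"
      using A by linarith+
    ultimately have "coeff (balanced_poly \<theta> n0 n2) (p - 2) = 0"
      by (simp only: coeff_balanced_poly_top mult_1_right)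
    moreover have "coeff (balanced_poly \<theta> n0 n2) (p - 2) \<noteq> 0"
      by (rule coeff_balanced_poly_minus_4_nonzero[OF \<theta>_nonzero digits(1,3)]) (simp add: A)
    ultimately show False
      by simp
  qed
qed

end

section \<open>Exponents congruent to p + 2\<close>

locale degree_2_plus_p = quadratic_subfield p F Q \<theta>
  for p and F :: "'a::{finite, field} itself" and Q and \<theta> :: 'a +
  fixes n :: nat
  assumes PN: "power_2PN n" and pow: "\<And>x :: 'a. x \<in> K \<Longrightarrow> x ^ n = x\<^sup>2 * x ^ p"
begin

text \<open>In contrast to the case of a cube, \<open>(x + s) ^ n + (x - s) ^ n\<close> now involves both \<open>s\<^sup>2\<close> and \<open>s ^ (p + 1)\<close>. Again
  \<open>\<kappa>\<close> collects everything that does not depend on \<open>s\<close>.\<close>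

definition \<kappa> :: "'a \<Rightarrow> 'a" where
  "\<kappa> x = (x + \<theta>) ^ n + (x - \<theta>) ^ n - 2 * (x\<^sup>2 * x ^ p)"

lemma symmetric_difference_eq:
  assumes "x \<in> K" and "s \<in> K"
  shows "(x + s) ^ n + (x - s) ^ n - (x + \<theta>) ^ n - (x - \<theta>) ^ n =
    2 * s\<^sup>2 * x ^ p + 4 * s ^ (p + 1) * x - \<kappa> x"
proof -
  have "(x + s) ^ n = (x + s)\<^sup>2 * (x ^ p + s ^ p)" "(x - s) ^ n = (x - s)\<^sup>2 * (x ^ p - s ^ p)"
    using assms by (simp_all add: pow p_power_add p_power_diff)
  then show ?thesis
    by (simp add: \<kappa>_def power2_eq_square algebra_simps)
qed

lemma inj_on_remainder_map:
  assumes "s \<in> K"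
  shows "inj_on (\<lambda>x. 2 * s\<^sup>2 * x ^ p + 4 * s ^ (p + 1) * x - \<kappa> x) K"
  using inj_on_symmetric_difference[OF PN \<theta>_nonzero \<theta>_power assms] assms
  by (simp only: symmetric_difference_eq cong: inj_on_cong)

lemma sum_powers_remainder_map:
  assumes "s \<in> K" and "0 < m" and "m < Q - 1"
  shows "(\<Sum>x\<in>K. (2 * s\<^sup>2 * x ^ p + 4 * s ^ (p + 1) * x - \<kappa> x) ^ m) = 0"
  using sum_symmetric_difference_power[OF PN \<theta>_nonzero \<theta>_power assms] assms(1)
  by (simp only: symmetric_difference_eq cong: sum.cong)

text \<open>With \<open>p + 1 = 2 * h\<close>, two solutions differ by a multiple of \<open>(h, - 1)\<close>. Increasing \<open>b\<close> is impossible
  since \<open>i < h\<close>, and decreasing \<open>b\<close> increases \<open>a + b\<close> by at least \<open>h - 1 \<ge> 2\<close>.\<close>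

lemma exponent_unique:
  fixes a b i j :: nat
  assumes "2 * a + (p + 1) * b = 2 * i + (p + 1) * j" and "2 * i < p" and "a + b \<le> i + j + 1"
  shows "a = i \<and> b = j"
proof -
  obtain h where h: "p + 1 = 2 * h"
    using odd_p by (metis even_Suc Suc_eq_plus1 dvdE)
  have h3: "3 \<le> h"
    using h p_ge_5 by simp
  have "2 * (a + h * b) = 2 * (i + h * j)"
    using assms(1) unfolding h by (simp add: algebra_simps)
  then have eq: "a + h * b = i + h * j"
    by simp
  consider "b = j" | d where "b = j + d" "1 \<le> d" | d where "j = b + d" "1 \<le> d"
    by (metis le_Suc_ex less_or_eq_imp_le linorder_neqE_nat less_imp_Suc_add Suc_eq_plus1 le_add2 add.assoc plus_1_eq_Suc add_Suc_right)
  then show ?thesis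
  proof cases
    case 1
    then show ?thesis
      using eq by simp
  next
    case 2
    have "h * 1 \<le> h * d"
      using 2 by (intro mult_le_mono2)
    then show ?thesis
      using eq assms(2) h unfolding 2(1) distrib_left mult_1_right by linarith
  next
    case 3
    have "3 * d \<le> h * d"
      using h3 by simp
    then show ?thesis
      using eq assms(3) 3(2) unfolding 3(1) distrib_left by linarith
  qed
qed

text \<open>The coefficient of \<open>s ^ (2 * i + (p + 1) * j)\<close> in the sum of the powers with exponent \<open>m = i + j + 1\<close>.
  As \<open>m < p\<close>, this exponent of \<open>s\<close> arises in one way only, with a single factor \<open>\<kappa> x\<close>.\<close>

lemma remainder_moment_eq_0:
  assumes i: "2 * i < p" and ij: "0 < i + j" "i + j + 2 \<le> p"
  shows "(\<Sum>x\<in>K. x ^ (j + p * i) * \<kappa> x) = 0"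
proof -
  define m where "m = i + j + 1"
  define T where "T = 2 * i + (p + 1) * j"
  \<comment> \<open>Multiplication by \<open>s ^ e\<close> moves the wanted exponent \<open>T\<close> to \<open>Q - 1\<close>.\<close>
  define e where "e = Q - 1 - T"
  have Qp: "Q - 1 = (p + 1) * (p - 1)"
    unfolding Q_eq power2_eq_square using p_ge_5 by (cases p) simp_all
  have weight_le: "2 * a + (p + 1) * b \<le> (p + 1) * (a + b)" for a b
    using p_ge_5 by (simp add: algebra_simps)
  have "T \<le> (p + 1) * (i + j)"
    unfolding T_def by (rule weight_le)
  also have "\<dots> < (p + 1) * (p - 1)"
    using ij by (intro mult_less_mono2) auto
  finally have T: "T < Q - 1"
    unfolding Qp .
  have T0: "0 < T"
    using ij p_ge_5 by (auto simp: T_def)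
  have "1 * (p - 1) < (p + 1) * (p - 1)"
    using p_ge_5 by (intro mult_less_mono1) auto
  then have mp: "m < p" "m < Q - 1" "0 < m"
    using ij unfolding Qp by (auto simp: m_def)
  have S: "(\<Sum>s\<in>K. s ^ (e + (2 * a + (p + 1) * b))) = (if a = i \<and> b = j then - 1 else 0)"
    if ab: "a + b \<le> m" for a b
  proof -
    let ?T = "2 * a + (p + 1) * b"
    have "(p + 1) * (a + b) \<le> (p + 1) * (p - 1)"
      using ab ij by (intro mult_le_mono2) (auto simp: m_def)
    then have T': "?T \<le> Q - 1"
      using weight_le[of a b] unfolding Qp by simp
    have "0 < e + ?T \<and> (Q - 1) dvd (e + ?T) \<longleftrightarrow> a = i \<and> b = j"
    proof
      assume d: "0 < e + ?T \<and> (Q - 1) dvd (e + ?T)"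
      moreover have "e + ?T < 2 * (Q - 1)"
        using T T0 T' by (simp add: e_def)
      ultimately have "e + ?T = Q - 1"
        by (intro dvd_less_double_imp_eq) auto
      then have "?T = T"
        using T by (simp add: e_def)
      then show "a = i \<and> b = j"
        unfolding T_def by (rule exponent_unique) (use i ab in \<open>auto simp: m_def\<close>)
    next
      assume "a = i \<and> b = j"
      then have "e + ?T = Q - 1"
        using T by (simp add: e_def T_def)
      then show "0 < e + ?T \<and> (Q - 1) dvd (e + ?T)"
        using Q_ge_5 by simp
    qed
    then show ?thesis
      unfolding sum_power by (simp only:)
  qed
  define I where "I = (SIGMA l:{..m}. {..l})"
  define c :: "nat \<times> nat \<Rightarrow> 'a \<Rightarrow> 'a" where "c = (\<lambda>(l, a) x. of_nat (m choose l) * of_nat (l choose a) *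
      2 ^ a * 4 ^ (l - a) * (x ^ (l - a + p * a) * (- \<kappa> x) ^ (m - l)))"
  have expand: "s ^ e * (2 * s\<^sup>2 * x ^ p + 4 * s ^ (p + 1) * x - \<kappa> x) ^ m =
      (\<Sum>la\<in>I. c la x * s ^ (e + (2 * snd la + (p + 1) * (fst la - snd la))))" for s x
  proof -
    have "s ^ e * (2 * s\<^sup>2 * x ^ p + 4 * s ^ (p + 1) * x - \<kappa> x) ^ m =
      (\<Sum>l\<le>m. \<Sum>a\<le>l. s ^ e * (of_nat (m choose l) * (of_nat (l choose a) * (2 * s\<^sup>2 * x ^ p) ^ a *
        (4 * s ^ (p + 1) * x) ^ (l - a)) * (- \<kappa> x) ^ (m - l)))"
      unfolding diff_conv_add_uminus binomial_ring
      unfolding sum_distrib_left sum_distrib_right ..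
    also have "\<dots> = (\<Sum>(l, a)\<in>I. s ^ e * (of_nat (m choose l) * (of_nat (l choose a) * (2 * s\<^sup>2 * x ^ p) ^ a *
        (4 * s ^ (p + 1) * x) ^ (l - a)) * (- \<kappa> x) ^ (m - l)))"
      unfolding I_def by (rule sum.Sigma) auto
    also have "\<dots> = (\<Sum>la\<in>I. c la x * s ^ (e + (2 * snd la + (p + 1) * (fst la - snd la))))"
    proof (rule sum.cong)
      fix la
      assume "la \<in> I"
      obtain l a where la: "la = (l, a)"
        by fastforce
      have "s ^ (e + (2 * a + (p + 1) * (l - a))) = s ^ e * ((s\<^sup>2) ^ a * (s ^ (p + 1)) ^ (l - a))"
        by (simp only: power_add power_mult)
      moreover have "x ^ (l - a + p * a) = x ^ (l - a) * (x ^ p) ^ a"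
        by (simp only: power_add power_mult)
      ultimately show "(case la of (l, a) \<Rightarrow> s ^ e * (of_nat (m choose l) * (of_nat (l choose a) * (2 * s\<^sup>2 * x ^ p) ^ a *
        (4 * s ^ (p + 1) * x) ^ (l - a)) * (- \<kappa> x) ^ (m - l))) =
        c la x * s ^ (e + (2 * snd la + (p + 1) * (fst la - snd la)))"
        unfolding la c_def by (simp only: prod.case fst_conv snd_conv power_mult_distrib) (simp only: ac_simps)
    qed simp
    finally show ?thesis .
  qed
  have "0 = (\<Sum>s\<in>K. s ^ e * (\<Sum>x\<in>K. (2 * s\<^sup>2 * x ^ p + 4 * s ^ (p + 1) * x - \<kappa> x) ^ m))"
    using sum_powers_remainder_map mp by simp
  also have "\<dots> = (\<Sum>s\<in>K. \<Sum>x\<in>K. \<Sum>la\<in>I. c la x * s ^ (e + (2 * snd la + (p + 1) * (fst la - snd la))))"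
    unfolding sum_distrib_left expand ..
  also have "\<dots> = (\<Sum>la\<in>I. \<Sum>x\<in>K. c la x * (\<Sum>s\<in>K. s ^ (e + (2 * snd la + (p + 1) * (fst la - snd la)))))"
    unfolding sum_distrib_left by (rule sum_reverse_order)
  also have "\<dots> = (\<Sum>la\<in>I. if la = (i + j, i) then \<Sum>x\<in>K. - c (i + j, i) x else 0)"
  proof (rule sum.cong)
    fix la
    assume la: "la \<in> I"
    have "(\<Sum>s\<in>K. s ^ (e + (2 * snd la + (p + 1) * (fst la - snd la)))) =
        (if snd la = i \<and> fst la - snd la = j then - 1 else 0)"
      by (rule S) (use la in \<open>auto simp: I_def\<close>)
    also have "(snd la = i \<and> fst la - snd la = j) \<longleftrightarrow> la = (i + j, i)"
      using la by (cases la) (auto simp: I_def)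
    finally show "(\<Sum>x\<in>K. c la x * (\<Sum>s\<in>K. s ^ (e + (2 * snd la + (p + 1) * (fst la - snd la))))) =
        (if la = (i + j, i) then \<Sum>x\<in>K. - c (i + j, i) x else 0)"
      by simp
  qed simp
  also have "\<dots> = (\<Sum>x\<in>K. - c (i + j, i) x)"
    by (subst sum.delta) (auto simp: I_def m_def)
  also have "\<dots> = of_nat m * of_nat (i + j choose i) * 2 ^ i * 4 ^ j * (\<Sum>x\<in>K. x ^ (j + p * i) * \<kappa> x)"
  proof -
    have "m choose (i + j) = m"
      by (simp add: m_def)
    then have "- c (i + j, i) x = of_nat m * of_nat (i + j choose i) * 2 ^ i * 4 ^ j * (x ^ (j + p * i) * \<kappa> x)" for x
      by (simp add: c_def m_def del: of_nat_Suc)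
    then show ?thesis
      by (simp only: sum_distrib_left)
  qed
  finally have "of_nat m * of_nat (i + j choose i) * 2 ^ i * 4 ^ j * (\<Sum>x\<in>K. x ^ (j + p * i) * \<kappa> x) = 0"
    by simp
  moreover have "of_nat m \<noteq> (0::'a)"
    by (rule of_nat_nonzero) (use mp in auto)
  moreover have "of_nat (i + j choose i) \<noteq> (0::'a)"
    by (rule of_nat_binomial_nonzero) (use ij in auto)
  ultimately show ?thesis
    using numerals_nonzero by simp
qed

text \<open>The exponent \<open>m = 2 * p + 2\<close> turns the power into the product of the square of
  \<open>2 * s\<^sup>2 * x ^ p + 4 * s ^ (p + 1) * x - \<kappa> x\<close> and the square of its conjugate, a polynomial in \<open>s\<close> and \<open>s ^ p\<close>.
  The claim is the coefficient of \<open>s\<^sup>2 * (s ^ p)\<^sup>2\<close>. Its first term contains the norm of \<open>\<kappa> x\<close>, which is what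
  makes this moment useful when \<open>\<kappa>\<close> is a polynomial in \<open>x\<close> of small degree.\<close>

lemma remainder_norm_moment_eq_0:
  assumes "p \<ge> 7"
  shows "(\<Sum>x\<in>K. 80 * (x * x ^ p * \<kappa> x * \<kappa> x ^ p) + 16 * x\<^sup>2 * (\<kappa> x ^ p)\<^sup>2 + 16 * (x ^ p)\<^sup>2 * (\<kappa> x)\<^sup>2) = 0"
proof -
  define e where "e = Q - 1 - (2 + p * 2)"
  have sq: "Q = p * p" "7 * p \<le> p * p"
    using assms Q_eq by (auto simp: power2_eq_square)
  have e: "e + (2 + p * 2) = Q - 1" "5 * p \<le> e + 3"
  proof -
    have "7 * p \<le> R \<Longrightarrow> R - 1 - (2 + p * 2) + (2 + p * 2) = R - 1 \<and> 5 * p \<le> R - 1 - (2 + p * 2) + 3" for R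
      using assms by presburger
    then show "e + (2 + p * 2) = Q - 1" "5 * p \<le> e + 3"
      using sq by (simp_all add: e_def)
  qed
  \<comment> \<open>\<open>T\<close> extracts from a polynomial in \<open>s\<close> and \<open>s ^ p\<close> the coefficient of \<open>s\<^sup>2 * (s ^ p)\<^sup>2\<close>; all exponents that
    occur are at most \<open>6\<close>.\<close>
  define T where "T a b = (\<Sum>s\<in>K. s ^ e * (s ^ a * (s ^ p) ^ b))" for a b
  have T: "T a b = (if a = 2 \<and> b = 2 then - 1 else 0)" if ab: "a \<le> 6" "b \<le> 6" for a b
  proof -
    have "0 < e + (a + p * b) \<and> (Q - 1) dvd (e + (a + p * b)) \<longleftrightarrow> a = 2 \<and> b = 2"
    proof
      assume d: "0 < e + (a + p * b) \<and> (Q - 1) dvd (e + (a + p * b))"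
      have "p * b \<le> p * 6"
        using ab by (intro mult_le_mono2)
      then have "e + (a + p * b) < 2 * (Q - 1)"
        using e(2) ab assms unfolding e(1)[symmetric] distrib_left by linarith
      then have "e + (a + p * b) = Q - 1"
        using d by (intro dvd_less_double_imp_eq) auto
      then have eq: "a + p * b = 2 + p * 2"
        using e(1) by linarith
      then have "(a + p * b) mod p = (2 + p * 2) mod p"
        by (rule arg_cong)
      then have "a mod p = 2 mod p"
        by (simp only: mod_mult_self2)
      then have "a = 2"
        using ab assms by simp
      then show "a = 2 \<and> b = 2"
        using eq assms by simp
    next
      assume "a = 2 \<and> b = 2"
      then show "0 < e + (a + p * b) \<and> (Q - 1) dvd (e + (a + p * b))"
        using e(1) Q_ge_5 by simp
    qed
    moreover have "T a b = (\<Sum>s\<in>K. s ^ (e + (a + p * b)))"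
      by (simp add: T_def power_add power_mult)
    ultimately show ?thesis
      unfolding sum_power by (simp only:)
  qed
  have \<kappa>_K: "\<kappa> x \<in> K" if x: "x \<in> K" for x
  proof -
    have "- \<kappa> x \<in> K"
      using symmetric_difference_in_K[OF \<theta>_power x K_closed(1), of n]
      unfolding symmetric_difference_eq[OF x K_closed(1)] by simp
    then show ?thesis
      using K_minus[of "- \<kappa> x"] by simp
  qed
  have inner: "(\<Sum>s\<in>K. s ^ e * (2 * s\<^sup>2 * x ^ p + 4 * s ^ (p + 1) * x - \<kappa> x) ^ (2 + p * 2)) =
      - (80 * (x * x ^ p * \<kappa> x * \<kappa> x ^ p) + 16 * x\<^sup>2 * (\<kappa> x ^ p)\<^sup>2 + 16 * (x ^ p)\<^sup>2 * (\<kappa> x)\<^sup>2)"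
    if x: "x \<in> K" for x
  proof -
    define Z k l where "Z = x ^ p" and "k = \<kappa> x" and "l = \<kappa> x ^ p"
    have "(\<Sum>s\<in>K. s ^ e * (2 * s\<^sup>2 * x ^ p + 4 * s ^ (p + 1) * x - \<kappa> x) ^ (2 + p * 2)) =
      (\<Sum>s\<in>K. s ^ e * ((4 * Z\<^sup>2 * (s ^ 4 * (s ^ p) ^ 0) + 16 * x * Z * (s ^ 3 * (s ^ p) ^ 1) + 16 * x\<^sup>2 * (s\<^sup>2 * (s ^ p)\<^sup>2)
          - 4 * k * Z * (s\<^sup>2 * (s ^ p) ^ 0) - 8 * k * x * (s ^ 1 * (s ^ p) ^ 1) + k\<^sup>2) *
        (4 * x\<^sup>2 * (s ^ 0 * (s ^ p) ^ 4) + 16 * x * Z * (s ^ 1 * (s ^ p) ^ 3) + 16 * Z\<^sup>2 * (s\<^sup>2 * (s ^ p)\<^sup>2)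
          - 4 * l * x * (s ^ 0 * (s ^ p)\<^sup>2) - 8 * l * Z * (s ^ 1 * (s ^ p) ^ 1) + l\<^sup>2)))"
    proof (rule sum.cong)
      fix s
      assume s: "s \<in> K"
      define t where "t = s ^ p"
      have ts: "t ^ p = s" "Z ^ p = x"
        using K_power_p_p[OF s] K_power_p_p[OF x] by (simp_all add: t_def Z_def)
      have E: "2 * s\<^sup>2 * x ^ p + 4 * s ^ (p + 1) * x - \<kappa> x = 2 * s\<^sup>2 * Z + 4 * (t * s) * x - k"
        by (simp add: Z_def t_def k_def)
      have num: "(2::'a) ^ p = 2" "(4::'a) ^ p = 4"
        using frobenius_numeral[of _ 1] by simp_all
      have sq: "(s\<^sup>2) ^ p = t\<^sup>2"
        by (simp add: t_def mult.commute flip: power_mult)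
      have "(2 * s\<^sup>2 * Z + 4 * (t * s) * x - k) ^ p = 2 * t\<^sup>2 * x + 4 * (s * t) * Z - l"
        unfolding p_power_diff p_power_add power_mult_distrib num sq ts by (simp add: t_def Z_def l_def k_def)
      then have "(2 * s\<^sup>2 * x ^ p + 4 * s ^ (p + 1) * x - \<kappa> x) ^ (2 + p * 2) =
          (2 * s\<^sup>2 * Z + 4 * (t * s) * x - k)\<^sup>2 * (2 * t\<^sup>2 * x + 4 * (s * t) * Z - l)\<^sup>2"
        unfolding E by (simp only: power_add[of _ 2 "p * 2"] power_mult[of _ p 2])
      moreover have "(2 * s\<^sup>2 * Z + 4 * (t * s) * x - k)\<^sup>2 =
          4 * Z\<^sup>2 * (s ^ 4 * t ^ 0) + 16 * x * Z * (s ^ 3 * t ^ 1) + 16 * x\<^sup>2 * (s\<^sup>2 * t\<^sup>2)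
          - 4 * k * Z * (s\<^sup>2 * t ^ 0) - 8 * k * x * (s ^ 1 * t ^ 1) + k\<^sup>2"
        by (simp add: power2_eq_square power3_eq_cube power4_eq_xxxx algebra_simps)
      moreover have "(2 * t\<^sup>2 * x + 4 * (s * t) * Z - l)\<^sup>2 =
          4 * x\<^sup>2 * (s ^ 0 * t ^ 4) + 16 * x * Z * (s ^ 1 * t ^ 3) + 16 * Z\<^sup>2 * (s\<^sup>2 * t\<^sup>2)
          - 4 * l * x * (s ^ 0 * t\<^sup>2) - 8 * l * Z * (s ^ 1 * t ^ 1) + l\<^sup>2"
        by (simp add: power2_eq_square power3_eq_cube power4_eq_xxxx algebra_simps)
      ultimately show "s ^ e * (2 * s\<^sup>2 * x ^ p + 4 * s ^ (p + 1) * x - \<kappa> x) ^ (2 + p * 2) =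
        s ^ e * ((4 * Z\<^sup>2 * (s ^ 4 * (s ^ p) ^ 0) + 16 * x * Z * (s ^ 3 * (s ^ p) ^ 1) + 16 * x\<^sup>2 * (s\<^sup>2 * (s ^ p)\<^sup>2)
          - 4 * k * Z * (s\<^sup>2 * (s ^ p) ^ 0) - 8 * k * x * (s ^ 1 * (s ^ p) ^ 1) + k\<^sup>2) *
        (4 * x\<^sup>2 * (s ^ 0 * (s ^ p) ^ 4) + 16 * x * Z * (s ^ 1 * (s ^ p) ^ 3) + 16 * Z\<^sup>2 * (s\<^sup>2 * (s ^ p)\<^sup>2)
          - 4 * l * x * (s ^ 0 * (s ^ p)\<^sup>2) - 8 * l * Z * (s ^ 1 * (s ^ p) ^ 1) + l\<^sup>2))"
        unfolding t_def[symmetric] by (simp only:)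
    qed simp
    also have "\<dots> = ((4 * Z\<^sup>2) * (4 * x\<^sup>2)) * T 4 4 + ((4 * Z\<^sup>2) * (16 * x * Z)) * T 5 3 +
        ((4 * Z\<^sup>2) * (16 * Z\<^sup>2)) * T 6 2 + ((4 * Z\<^sup>2) * ((- 4) * l * x)) * T 4 2 +
        ((4 * Z\<^sup>2) * ((- 8) * l * Z)) * T 5 1 + ((4 * Z\<^sup>2) * (l\<^sup>2)) * T 4 0 +
        ((16 * x * Z) * (4 * x\<^sup>2)) * T 3 5 + ((16 * x * Z) * (16 * x * Z)) * T 4 4 +
        ((16 * x * Z) * (16 * Z\<^sup>2)) * T 5 3 + ((16 * x * Z) * ((- 4) * l * x)) * T 3 3 +
        ((16 * x * Z) * ((- 8) * l * Z)) * T 4 2 + ((16 * x * Z) * (l\<^sup>2)) * T 3 1 +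
        ((16 * x\<^sup>2) * (4 * x\<^sup>2)) * T 2 6 + ((16 * x\<^sup>2) * (16 * x * Z)) * T 3 5 +
        ((16 * x\<^sup>2) * (16 * Z\<^sup>2)) * T 4 4 + ((16 * x\<^sup>2) * ((- 4) * l * x)) * T 2 4 +
        ((16 * x\<^sup>2) * ((- 8) * l * Z)) * T 3 3 + ((16 * x\<^sup>2) * (l\<^sup>2)) * T 2 2 +
        (((- 4) * k * Z) * (4 * x\<^sup>2)) * T 2 4 + (((- 4) * k * Z) * (16 * x * Z)) * T 3 3 +
        (((- 4) * k * Z) * (16 * Z\<^sup>2)) * T 4 2 + (((- 4) * k * Z) * ((- 4) * l * x)) * T 2 2 +
        (((- 4) * k * Z) * ((- 8) * l * Z)) * T 3 1 + (((- 4) * k * Z) * (l\<^sup>2)) * T 2 0 +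
        (((- 8) * k * x) * (4 * x\<^sup>2)) * T 1 5 + (((- 8) * k * x) * (16 * x * Z)) * T 2 4 +
        (((- 8) * k * x) * (16 * Z\<^sup>2)) * T 3 3 + (((- 8) * k * x) * ((- 4) * l * x)) * T 1 3 +
        (((- 8) * k * x) * ((- 8) * l * Z)) * T 2 2 + (((- 8) * k * x) * (l\<^sup>2)) * T 1 1 +
        ((k\<^sup>2) * (4 * x\<^sup>2)) * T 0 4 + ((k\<^sup>2) * (16 * x * Z)) * T 1 3 +
        ((k\<^sup>2) * (16 * Z\<^sup>2)) * T 2 2 + ((k\<^sup>2) * ((- 4) * l * x)) * T 0 2 +
        ((k\<^sup>2) * ((- 8) * l * Z)) * T 1 1 + ((k\<^sup>2) * (l\<^sup>2)) * T 0 0"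
      unfolding T_def sum_distrib_left sum.distrib[symmetric]
      by (rule sum.cong) (simp_all add: algebra_simps power_add power2_eq_square power3_eq_cube power4_eq_xxxx eval_nat_numeral)
    also have "\<dots> = - (80 * (x * Z * k * l) + 16 * x\<^sup>2 * l\<^sup>2 + 16 * Z\<^sup>2 * k\<^sup>2)"
      by (simp add: T power2_eq_square algebra_simps)
    finally show ?thesis
      by (simp add: Z_def k_def l_def)
  qed
  have "0 = (\<Sum>s\<in>K. s ^ e * (\<Sum>x\<in>K. (2 * s\<^sup>2 * x ^ p + 4 * s ^ (p + 1) * x - \<kappa> x) ^ (2 + p * 2)))"
  proof -
    have "2 + p * 2 < Q - 1"
      using e assms by linarith
    then have "(\<Sum>x\<in>K. (2 * s\<^sup>2 * x ^ p + 4 * s ^ (p + 1) * x - \<kappa> x) ^ (2 + p * 2)) = 0" if "s \<in> K" for s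
      by (intro sum_powers_remainder_map[OF that]) simp
    then show ?thesis
      by (simp only: mult_zero_right sum.neutral_const cong: sum.cong)
  qed
  also have "\<dots> = (\<Sum>x\<in>K. \<Sum>s\<in>K. s ^ e * (2 * s\<^sup>2 * x ^ p + 4 * s ^ (p + 1) * x - \<kappa> x) ^ (2 + p * 2))"
    unfolding sum_distrib_left by (rule sum.swap)
  also have "\<dots> = - (\<Sum>x\<in>K. 80 * (x * x ^ p * \<kappa> x * \<kappa> x ^ p) + 16 * x\<^sup>2 * (\<kappa> x ^ p)\<^sup>2 + 16 * (x ^ p)\<^sup>2 * (\<kappa> x)\<^sup>2)"
    by (simp only: inner sum_negf cong: sum.cong)
  finally show ?thesis
    by simp
qed

end

context quartic_subfield
begin

text \<open>Euler's criterion. The squaring map on the nonzero elements has fibres with at most two elements, so its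
  image contains at least \<open>(Q - 1) div 2\<close> elements, and these are all the roots of
  \<open>x ^ ((Q - 1) div 2) = 1\<close>.\<close>

lemma K_square_iff:
  assumes "w \<in> K"
  shows "(\<exists>s\<in>K. s\<^sup>2 = w) \<longleftrightarrow> w = 0 \<or> w ^ ((Q - 1) div 2) = 1"
proof -
  define h where "h = (Q - 1) div 2"
  have h: "Q - 1 = 2 * h" "0 < h"
    using odd_Q Q_ge_5 by (auto simp: h_def)
  let ?S = "{x::'a. x ^ (Q - 1) = 1}" and ?R = "{x::'a. x ^ h = 1}"
  have cS: "card ?S = 2 * h" and cR: "card ?R = h"
    using card_roots_of_unity[of "2 * h", where ?'a = 'a] card_roots_of_unity[of h, where ?'a = 'a]
      two_Q_minus_1_dvd unfolding h(1) by (auto elim: dvd_mult_right intro: dvd_trans[rotated])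
  have sub: "(\<lambda>x. x\<^sup>2) ` ?S \<subseteq> ?R"
    unfolding h(1) by (auto simp flip: power_mult)
  have "card ?S = (\<Sum>y\<in>(\<lambda>x. x\<^sup>2) ` ?S. card {x \<in> ?S. x\<^sup>2 = y})"
    using sum.image_gen[of ?S "\<lambda>_. 1::nat" "\<lambda>x. x\<^sup>2"] by simp
  also have "\<dots> \<le> (\<Sum>y\<in>(\<lambda>x. x\<^sup>2) ` ?S. 2)"
  proof (rule sum_mono)
    fix y :: 'a
    have "card {x \<in> ?S. x\<^sup>2 = y} \<le> card {x. x\<^sup>2 = y}"
      by (rule card_mono) auto
    also have "\<dots> \<le> 2"
      by (rule card_roots_power_le) simp
    finally show "card {x \<in> ?S. x\<^sup>2 = y} \<le> 2" .
  qed
  finally have "card ?R \<le> card ((\<lambda>x. x\<^sup>2) ` ?S)"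
    unfolding cS cR by simp
  then have image: "(\<lambda>x. x\<^sup>2) ` ?S = ?R"
    using sub by (intro card_seteq) auto
  show ?thesis
  proof
    assume "\<exists>s\<in>K. s\<^sup>2 = w"
    then obtain s where s: "s \<in> K" "s\<^sup>2 = w"
      by auto
    show "w = 0 \<or> w ^ ((Q - 1) div 2) = 1"
    proof (cases "s = 0")
      case False
      then have "s \<in> ?S"
        using s K_nonzero by simp
      then have "w \<in> ?R"
        using s image by blast
      then show ?thesis
        by (simp add: h_def)
    qed (use s in simp)
  next
    assume "w = 0 \<or> w ^ ((Q - 1) div 2) = 1"
    then show "\<exists>s\<in>K. s\<^sup>2 = w"
    proof
      assume "w ^ ((Q - 1) div 2) = 1"
      then have "w \<in> (\<lambda>x. x\<^sup>2) ` ?S"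
        unfolding image by (simp add: h_def)
      then show ?thesis
        unfolding K_eq by auto
    qed (auto intro: bexI[of _ 0])
  qed
qed

end

context quadratic_subfield
begin

text \<open>The map is linear over the prime field, and if the norms agree its kernel contains all elements
  \<open>\<alpha> * y - \<gamma> ^ p * y ^ p\<close>. If these are all zero, then \<open>\<alpha> = \<gamma> = 0\<close>.\<close>

lemma not_inj_on_of_norm_eq:
  assumes "\<alpha> \<in> K" and "\<gamma> \<in> K" and norm: "\<alpha> * \<alpha> ^ p = \<gamma> * \<gamma> ^ p"
  shows "\<not> inj_on (\<lambda>x. \<alpha> * x ^ p + \<gamma> * x) K"
proof
  assume inj: "inj_on (\<lambda>x. \<alpha> * x ^ p + \<gamma> * x) K"
  have kernel: "x = 0" if "x \<in> K" "\<alpha> * x ^ p + \<gamma> * x = 0" for x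
    using inj_onD[OF inj, of x 0] that p_ge_5 by simp
  have zero: "\<alpha> * y - \<gamma> ^ p * y ^ p = 0" if y: "y \<in> K" for y
  proof (rule kernel)
    show "\<alpha> * y - \<gamma> ^ p * y ^ p \<in> K"
      using assms y by simp
    have "\<alpha> * (\<alpha> * y - \<gamma> ^ p * y ^ p) ^ p + \<gamma> * (\<alpha> * y - \<gamma> ^ p * y ^ p) =
        \<alpha> * (\<alpha> ^ p * y ^ p - \<gamma> * y) + \<gamma> * (\<alpha> * y - \<gamma> ^ p * y ^ p)"
      using K_power_p_p[OF y] K_power_p_p[OF assms(2)] by (simp add: p_power_diff power_mult_distrib)
    also have "\<dots> = y ^ p * (\<alpha> * \<alpha> ^ p - \<gamma> * \<gamma> ^ p)"
      by (simp add: algebra_simps)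
    finally show "\<alpha> * (\<alpha> * y - \<gamma> ^ p * y ^ p) ^ p + \<gamma> * (\<alpha> * y - \<gamma> ^ p * y ^ p) = 0"
      using norm by simp
  qed
  have \<alpha>: "\<alpha> = \<gamma> ^ p"
    using zero[of 1] by simp
  have "card {y::'a. y ^ (p - 1) = 1} \<le> p - 1"
    by (rule card_roots_power_le) (use p_ge_5 in simp)
  also have "p - 1 < card (K - {0})"
  proof -
    have "p * 1 < p * p"
      using p_ge_5 by (intro mult_less_mono2) auto
    moreover have "card (K - {0}) = Q - 1"
      using card_K by (simp add: card_Diff_singleton)
    ultimately show ?thesis
      using p_ge_5 unfolding Q_eq power2_eq_square mult_1_right by linarith
  qed
  finally have "\<not> K - {0} \<subseteq> {y. y ^ (p - 1) = 1}"
    using card_mono[of "{y::'a. y ^ (p - 1) = 1}" "K - {0}"] by auto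
  then obtain y where y: "y \<in> K" "y \<noteq> 0" "y ^ (p - 1) \<noteq> 1"
    by auto
  have "y ^ p = y ^ (p - 1) * y"
    using p_ge_5 power_minus_mult[of p y] by simp
  then have "y - y ^ p \<noteq> 0"
    using y by simp
  moreover have "\<alpha> * (y - y ^ p) = 0"
    using zero[OF y(1)] \<alpha> by (simp add: algebra_simps)
  ultimately have "\<alpha> = 0"
    by simp
  then have "\<gamma> = 0"
    using \<alpha> by simp
  then show False
    using kernel[of 1] \<open>\<alpha> = 0\<close> by simp
qed

text \<open>The element \<open>\<theta>\<^sup>2\<close> is not a square in the subfield, while \<open>3\<close> is one. If no \<open>u\<close> of norm \<open>1\<close> worked, then
  \<open>c * u + d\<close> would be a nonzero square for all of them, so its norm
  \<open>(c * u + d) * (c + d * u) / u\<close> would be a nonzero square in the prime field. This means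
  \<open>((c * u + d) * (c + d * u)) ^ h = u ^ h\<close> for \<open>h = (p - 1) div 2\<close> and all \<open>p + 1\<close> elements \<open>u\<close> of norm \<open>1\<close>. Both
  sides have degree at most \<open>p - 1\<close> and so would be equal as polynomials, which fails at \<open>0\<close>.\<close>

lemma exists_norm_one_square:
  assumes c: "c \<noteq> 0" "c ^ p = c" and d: "d \<noteq> 0" "d ^ p = d"
  obtains u s :: 'a where "u * u ^ p = 1" "s \<in> K" "3 * s\<^sup>2 = \<theta>\<^sup>2 * (c * u + d)"
proof (rule ccontr)
  assume "\<not> thesis"
  with that have none: "\<And>u s :: 'a. u * u ^ p = 1 \<Longrightarrow> s \<in> K \<Longrightarrow> 3 * s\<^sup>2 \<noteq> \<theta>\<^sup>2 * (c * u + d)"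
    by blast
  obtain h where h: "p = 2 * h + 1"
    using odd_p by (rule oddE)
  have h0: "0 < h"
    using h p_ge_5 by simp
  have Q1: "Q - 1 = 2 * (h * (p + 1))"
    unfolding Q_eq h by (simp add: power2_eq_square algebra_simps)
  then have H: "(Q - 1) div 2 = h * (p + 1)"
    by simp
  have \<theta>2: "\<theta>\<^sup>2 \<in> K"
    using \<theta>_power by (simp add: fixed_field_def flip: power_mult) (simp add: mult.commute[of 2] power_mult)
  have "\<theta> ^ (Q - 1) * \<theta> = - 1 * \<theta>"
    using \<theta>_power power_minus_mult[of Q \<theta>] Q_ge_5 by simp
  then have "\<theta> ^ (Q - 1) = - 1"
    using \<theta>_nonzero by (metis mult_right_cancel)
  then have \<theta>H: "(\<theta>\<^sup>2) ^ (h * (p + 1)) = - 1"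
    unfolding Q1 power_mult .
  have "(3::'a) ^ (p - 1) * 3 = 1 * 3"
    using frobenius_numeral[of "num.Bit1 num.One" 1] power_minus_mult[of p "3::'a"] p_ge_5 by simp
  then have three: "(3::'a) ^ (2 * h) = 1"
    using numerals_nonzero(2) unfolding h by simp
  have "(3::'a) ^ (h * (p + 1)) = (3 ^ (2 * h)) ^ (h + 1)"
    unfolding power_mult[symmetric] h by (simp add: algebra_simps)
  then have three: "(3::'a) ^ (h * (p + 1)) = 1"
    using three by simp
  define G where "G = ([:d, c:] * [:c, d:]) ^ h - monom 1 h"
  have root: "poly G u = 0" if u: "u ^ (p + 1) = 1" for u
  proof -
    have uu: "u * u ^ p = 1"
      using u by simp
    then have u0: "u \<noteq> 0"
      by auto
    then have up: "u ^ p = 1 / u"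
      using uu by (simp add: eq_divide_eq mult.commute)
    have "(u ^ p) ^ p = u"
      unfolding up power_divide using up u0 by simp
    then have uK: "u \<in> K"
      by (simp add: fixed_field_def Q_eq power2_eq_square power_mult)
    have cK: "c \<in> K" "d \<in> K"
      using c d by (simp_all add: fixed_field_def Q_eq power2_eq_square power_mult)
    define w where "w = \<theta>\<^sup>2 * (c * u + d) / 3"
    have wK: "w \<in> K"
      unfolding w_def using uK cK \<theta>2 by simp
    have w3: "3 * w = \<theta>\<^sup>2 * (c * u + d)"
      using numerals_nonzero(2) by (simp add: w_def)
    have "\<not> (\<exists>s\<in>K. s\<^sup>2 = w)"
      using none[OF uu] w3 by auto
    then have w: "w \<noteq> 0" "w ^ (h * (p + 1)) \<noteq> 1"
      using K_square_iff[OF wK] unfolding H by auto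
    have "(w ^ (h * (p + 1)))\<^sup>2 = 1"
      using K_nonzero[OF wK w(1)] unfolding Q1 by (simp add: mult.commute flip: power_mult)
    then have "w ^ (h * (p + 1)) = - 1"
      using w(2) by (simp add: power2_eq_1_iff)
    then have "- 1 = (3 * w) ^ (h * (p + 1))"
      unfolding power_mult_distrib three by simp
    also have "\<dots> = - ((c * u + d) ^ (h * (p + 1)))"
      unfolding w3 power_mult_distrib \<theta>H by simp
    finally have "(c * u + d) ^ (h * (p + 1)) = 1"
      by simp
    then have "((c * u + d) * (c * u ^ p + d)) ^ h = 1"
      unfolding mult.commute[of h] power_mult by (simp add: p_power_add power_mult_distrib c d mult.commute)
    then have "u ^ h = (u * ((c * u + d) * (c * u ^ p + d))) ^ h"
      by (simp add: power_mult_distrib[of u])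
    also have "u * ((c * u + d) * (c * u ^ p + d)) = (c * u + d) * (c * (u * u ^ p) + d * u)"
      by (simp only: algebra_simps)
    also have "\<dots> = poly ([:d, c:] * [:c, d:]) u"
      unfolding uu by (simp add: algebra_simps)
    finally show ?thesis
      by (simp only: G_def poly_diff poly_power poly_monom) simp
  qed
  have "degree G \<le> 2 * h"
    unfolding G_def
  proof (rule degree_diff_le)
    have "degree ([:d, c:] * [:c, d:]) \<le> 1 + 1"
      by (rule order_trans[OF degree_mult_le]) (use c d in simp)
    then show "degree (([:d, c:] * [:c, d:]) ^ h) \<le> 2 * h"
      by (intro order_trans[OF degree_power_le]) simp
    show "degree (monom (1::'a) h) \<le> 2 * h"
      by (simp add: degree_monom_eq)
  qed
  moreover have "poly G 0 \<noteq> 0"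
    using c d h0 by (simp add: G_def poly_monom power_0_left)
  then have "G \<noteq> 0"
    by auto
  then have "card {u. poly G u = 0} \<le> degree G"
    by (rule card_poly_roots_bound)
  moreover have "card {u::'a. u ^ (p + 1) = 1} = p + 1"
  proof (rule card_roots_of_unity)
    have "p + 1 dvd 2 * (Q - 1)"
      unfolding Q1 by (intro dvd_mult dvd_refl)
    then show "p + 1 dvd CARD('a) - 1"
      using two_Q_minus_1_dvd by (rule dvd_trans)
  qed
  moreover have "card {u::'a. u ^ (p + 1) = 1} \<le> card {u. poly G u = 0}"
    by (rule card_mono) (use root in auto)
  ultimately show False
    using h by simp
qed

end

context degree_2_plus_p
begin

text \<open>Depending on the digits, \<open>\<kappa>\<close> is \<open>- 2 * \<theta>\<^sup>2 * x ^ p\<close> or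
  \<open>2 * \<theta>\<^sup>2 * x ^ p \<plusminus> 4 * \<theta> ^ (p + 1) * x\<close>. In both cases the permutation is \<open>\<alpha> * x ^ p + \<gamma> * x\<close> with \<open>\<alpha>\<close>, \<open>\<gamma>\<close>
  depending on \<open>s\<close>, and \<open>\<alpha>\<close>, \<open>\<gamma>\<close> have equal norms if \<open>s\<^sup>2\<close> lies on a certain conic. The conic is
  parametrized by the elements \<open>u\<close> of norm \<open>1\<close>, with \<open>3 * s\<^sup>2 = \<theta>\<^sup>2 * (2 * u + 1)\<close> in the first case and
  \<open>3 * s\<^sup>2 = \<theta>\<^sup>2 * (4 * u - 1)\<close> in the second one.\<close>

lemma digit_sums_2_and_1_contradiction:
  assumes n: "n = n0 + p * n1 + p\<^sup>2 * n2 + p ^ 3 * n3"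
    and "n0 + n2 = 2" and "n1 + n3 = 1"
  shows False
proof -
  define \<beta> \<eta> where "\<beta> = \<theta>\<^sup>2" and "\<eta> = \<theta> ^ (p + 1)"
  have \<beta>\<eta>: "\<eta>\<^sup>2 = \<beta> * \<beta> ^ p"
    by (simp add: \<beta>_def \<eta>_def power2_eq_square power_mult_distrib)
  have \<theta>pp: "(\<theta> ^ p) ^ p = - \<theta>"
    using \<theta>_power by (simp add: Q_eq power2_eq_square power_mult)
  have \<eta>p: "\<eta> ^ p = - \<eta>"
    unfolding \<eta>_def by (simp add: power_mult_distrib \<theta>pp)
  have inK: "\<beta> \<in> K" "\<eta> \<in> K"
  proof -
    have "\<eta> ^ Q = (\<eta> ^ p) ^ p"
      by (simp add: Q_eq power2_eq_square power_mult)
    then show "\<eta> \<in> K"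
      by (simp add: fixed_field_def \<eta>p p_power_minus)
    have "\<beta> ^ Q = (\<theta> ^ Q)\<^sup>2"
      by (simp add: \<beta>_def mult.commute flip: power_mult)
    then show "\<beta> \<in> K"
      by (simp add: fixed_field_def \<theta>_power \<beta>_def)
  qed
  have \<kappa>: "\<kappa> x = (x + \<theta>) ^ n0 * (x - \<theta>) ^ n2 * ((x ^ p + \<theta> ^ p) ^ n1 * (x ^ p - \<theta> ^ p) ^ n3) +
      (x - \<theta>) ^ n0 * (x + \<theta>) ^ n2 * ((x ^ p - \<theta> ^ p) ^ n1 * (x ^ p + \<theta> ^ p) ^ n3) - 2 * (x\<^sup>2 * x ^ p)"
    if "x \<in> K" for x
    unfolding \<kappa>_def power_digits_split[OF that, of n0 n1 n2 n3, folded n] poly_balanced_poly by simp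
  have "(n0 = 1 \<and> n2 = 1) \<or> (n0 = 2 \<and> n2 = 0) \<or> (n0 = 0 \<and> n2 = 2)"
    "(n1 = 1 \<and> n3 = 0) \<or> (n1 = 0 \<and> n3 = 1)"
    using assms by auto
  then have "(\<forall>x\<in>K. \<kappa> x = - 2 * \<beta> * x ^ p) \<or>
      (\<forall>x\<in>K. \<kappa> x = 2 * \<beta> * x ^ p + 4 * (1 * \<eta>) * x) \<or> (\<forall>x\<in>K. \<kappa> x = 2 * \<beta> * x ^ p + 4 * ((- 1) * \<eta>) * x)"
    by (elim disjE) (simp_all add: \<kappa> \<beta>_def \<eta>_def power2_eq_square algebra_simps)
  then consider "\<forall>x\<in>K. \<kappa> x = - 2 * \<beta> * x ^ p"
    | \<epsilon> where "\<epsilon> = 1 \<or> \<epsilon> = - 1" "\<forall>x\<in>K. \<kappa> x = 2 * \<beta> * x ^ p + 4 * (\<epsilon> * \<eta>) * x"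
    by blast
  then show False
  proof cases
    case 1
    obtain u s :: 'a where us: "u * u ^ p = 1" "s \<in> K" "3 * s\<^sup>2 = \<theta>\<^sup>2 * (2 * u + 1)"
      by (rule exists_norm_one_square[of 2 1]) (use numerals_nonzero frobenius_numeral[of _ 1] in auto)
    define S u' where "S = s ^ p" and "u' = u ^ p"
    have Sp: "S ^ p = s"
      unfolding S_def by (rule K_power_p_p[OF us(2)])
    have s3: "3 * s\<^sup>2 = \<beta> * (2 * u + 1)"
      using us(3) by (simp add: \<beta>_def)
    have num: "(2::'a) ^ p = 2" "(3::'a) ^ p = 3" "(4::'a) ^ p = 4"
      using frobenius_numeral[of _ 1] by simp_all
    have sq: "(s\<^sup>2) ^ p = S\<^sup>2"
      by (simp add: S_def mult.commute flip: power_mult)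
    have S3: "3 * S\<^sup>2 = \<beta> ^ p * (2 * u' + 1)"
      using arg_cong[OF s3, of "\<lambda>z. z ^ p"] by (simp add: power_mult_distrib p_power_add num sq u'_def)
    define \<alpha> \<gamma> where "\<alpha> = 2 * (s\<^sup>2 + \<beta>)" and "\<gamma> = 4 * (S * s)"
    have \<alpha>p: "\<alpha> ^ p = 2 * (S\<^sup>2 + \<beta> ^ p)" and \<gamma>p: "\<gamma> ^ p = 4 * (s * S)"
      by (simp_all add: \<alpha>_def \<gamma>_def power_mult_distrib p_power_add num sq Sp) (simp add: S_def)
    have "9 * (\<alpha> * \<alpha> ^ p) = 4 * ((3 * s\<^sup>2 + 3 * \<beta>) * (3 * S\<^sup>2 + 3 * \<beta> ^ p))"
      unfolding \<alpha>p by (simp add: \<alpha>_def algebra_simps)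
    also have "\<dots> = 16 * (\<beta> * \<beta> ^ p) * (u * u' + 2 * u + 2 * u' + 4)"
      unfolding s3 S3 by (simp add: algebra_simps)
    also have "\<dots> = 16 * (\<beta> * \<beta> ^ p) * (4 * (u * u') + 2 * u + 2 * u' + 1)"
      using us(1) by (simp add: u'_def)
    also have "\<dots> = 16 * ((3 * s\<^sup>2) * (3 * S\<^sup>2))"
      unfolding s3 S3 by (simp add: algebra_simps)
    also have "\<dots> = 9 * (\<gamma> * \<gamma> ^ p)"
      unfolding \<gamma>p by (simp add: \<gamma>_def power2_eq_square algebra_simps)
    finally have "9 * (\<alpha> * \<alpha> ^ p) = 9 * (\<gamma> * \<gamma> ^ p)" .
    moreover have "(9::'a) \<noteq> 0"
    proof -
      have "(9::'a) = 3 * 3"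
        by simp
      then show ?thesis
        using numerals_nonzero(2) by (metis mult_eq_0_iff)
    qed
    ultimately have norm: "\<alpha> * \<alpha> ^ p = \<gamma> * \<gamma> ^ p"
      by simp
    have "\<alpha> \<in> K" "\<gamma> \<in> K"
      unfolding \<alpha>_def \<gamma>_def S_def using us(2) inK by simp_all
    from not_inj_on_of_norm_eq[OF this norm] show False
    proof (rule notE)
      have eq: "2 * s\<^sup>2 * x ^ p + 4 * s ^ (p + 1) * x - \<kappa> x = \<alpha> * x ^ p + \<gamma> * x" if "x \<in> K" for x
        using 1 that by (simp add: \<alpha>_def \<gamma>_def S_def algebra_simps)
      show "inj_on (\<lambda>x. \<alpha> * x ^ p + \<gamma> * x) K"
        using inj_on_remainder_map[OF us(2)] by (simp only: eq cong: inj_on_cong)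
    qed
  next
    case 2
    have \<epsilon>: "\<epsilon> * \<epsilon> = 1" "\<epsilon> ^ p = \<epsilon>" "\<epsilon> \<in> K"
      using 2(1) by (auto simp: p_power_minus)
    obtain u s :: 'a where us: "u * u ^ p = 1" "s \<in> K" "3 * s\<^sup>2 = \<theta>\<^sup>2 * (4 * u + (- 1))"
      by (rule exists_norm_one_square[of 4 "- 1"]) (use numerals_nonzero frobenius_numeral[of _ 1] p_power_minus in auto)
    define S u' where "S = s ^ p" and "u' = u ^ p"
    have Sp: "S ^ p = s"
      unfolding S_def by (rule K_power_p_p[OF us(2)])
    have s3: "3 * s\<^sup>2 = \<beta> * (4 * u - 1)"
      using us(3) by (simp add: \<beta>_def)
    have num: "(2::'a) ^ p = 2" "(3::'a) ^ p = 3" "(4::'a) ^ p = 4"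
      using frobenius_numeral[of _ 1] by simp_all
    have sq: "(s\<^sup>2) ^ p = S\<^sup>2"
      by (simp add: S_def mult.commute flip: power_mult)
    have S3: "3 * S\<^sup>2 = \<beta> ^ p * (4 * u' - 1)"
      using arg_cong[OF s3, of "\<lambda>z. z ^ p"] by (simp add: power_mult_distrib p_power_diff num sq u'_def)
    define \<alpha> \<gamma> where "\<alpha> = 2 * (s\<^sup>2 - \<beta>)" and "\<gamma> = 4 * (S * s - \<epsilon> * \<eta>)"
    have \<alpha>p: "\<alpha> ^ p = 2 * (S\<^sup>2 - \<beta> ^ p)" and \<gamma>p: "\<gamma> ^ p = 4 * (s * S + \<epsilon> * \<eta>)"
      by (simp_all add: \<alpha>_def \<gamma>_def power_mult_distrib p_power_diff num sq Sp \<epsilon> \<eta>p) (simp add: S_def)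
    have "9 * (\<alpha> * \<alpha> ^ p) = 4 * ((3 * s\<^sup>2 - 3 * \<beta>) * (3 * S\<^sup>2 - 3 * \<beta> ^ p))"
      unfolding \<alpha>p by (simp add: \<alpha>_def algebra_simps)
    also have "\<dots> = 64 * (\<beta> * \<beta> ^ p) * (u * u' - u - u' + 1)"
      unfolding s3 S3 by (simp add: algebra_simps)
    also have "\<dots> = 16 * (\<beta> * \<beta> ^ p) * (16 * (u * u') - 4 * u - 4 * u' + 1 - 9)"
      using us(1) by (simp add: u'_def algebra_simps)
    also have "\<dots> = 16 * ((3 * s\<^sup>2) * (3 * S\<^sup>2) - 9 * (\<beta> * \<beta> ^ p))"
      unfolding s3 S3 by (simp add: algebra_simps)
    also have "\<dots> = 16 * ((3 * s\<^sup>2) * (3 * S\<^sup>2) - 9 * (\<epsilon> * \<epsilon>) * (\<eta> * \<eta>))"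
      using \<beta>\<eta> \<epsilon>(1) by (simp add: power2_eq_square)
    also have "\<dots> = 9 * (\<gamma> * \<gamma> ^ p)"
      unfolding \<gamma>p by (simp add: \<gamma>_def power2_eq_square algebra_simps)
    finally have "9 * (\<alpha> * \<alpha> ^ p) = 9 * (\<gamma> * \<gamma> ^ p)" .
    moreover have "(9::'a) \<noteq> 0"
    proof -
      have "(9::'a) = 3 * 3"
        by simp
      then show ?thesis
        using numerals_nonzero(2) by (metis mult_eq_0_iff)
    qed
    ultimately have norm: "\<alpha> * \<alpha> ^ p = \<gamma> * \<gamma> ^ p"
      by simp
    have "\<alpha> \<in> K" "\<gamma> \<in> K"
      unfolding \<alpha>_def \<gamma>_def S_def using us(2) inK \<epsilon> by simp_all
    from not_inj_on_of_norm_eq[OF this norm] show False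
    proof (rule notE)
      have eq: "2 * s\<^sup>2 * x ^ p + 4 * s ^ (p + 1) * x - \<kappa> x = \<alpha> * x ^ p + \<gamma> * x" if "x \<in> K" for x
        using 2(2) that by (simp add: \<alpha>_def \<gamma>_def S_def algebra_simps)
      show "inj_on (\<lambda>x. \<alpha> * x ^ p + \<gamma> * x) K"
        using inj_on_remainder_map[OF us(2)] by (simp only: eq cong: inj_on_cong)
    qed
  qed
qed

text \<open>The term \<open>2 * x\<^sup>2 * x ^ p\<close> contained in \<open>\<kappa>\<close> does not contribute, since its exponents stay below
  \<open>p\<^sup>2 - 1\<close>.\<close>

lemma sum_conjugate_pair_eq_0:
  assumes "2 * \<beta> < p" and "0 < \<alpha> + \<beta>" and "\<alpha> + \<beta> + 2 \<le> p"
  shows "(\<Sum>x\<in>K. x ^ (\<alpha> + p * \<beta>) * ((x + \<theta>) ^ n + (x - \<theta>) ^ n)) = 0"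
proof -
  have "(\<Sum>x\<in>K. x ^ (\<alpha> + p * \<beta>) * \<kappa> x) = 0"
    by (rule remainder_moment_eq_0) (use assms in auto)
  moreover have "(\<Sum>x\<in>K. x ^ (\<alpha> + 2 + p * (\<beta> + 1))) = 0"
  proof -
    have "p * (\<beta> + 2) \<le> p * (p - 1)"
      using assms(1) p_ge_5 by (intro mult_le_mono2) linarith
    then have "\<alpha> + 2 + p * (\<beta> + 1) < p * p - 1"
      using assms(3) p_ge_5 unfolding distrib_left diff_mult_distrib2 by linarith
    then have "\<alpha> + 2 + p * (\<beta> + 1) < Q - 1"
      by (simp only: Q_eq power2_eq_square)
    then show ?thesis
      unfolding sum_power by (auto dest: dvd_imp_le)
  qed
  moreover have "(\<Sum>x\<in>K. x ^ (\<alpha> + p * \<beta>) * ((x + \<theta>) ^ n + (x - \<theta>) ^ n)) =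
      (\<Sum>x\<in>K. x ^ (\<alpha> + p * \<beta>) * \<kappa> x) + 2 * (\<Sum>x\<in>K. x ^ (\<alpha> + 2 + p * (\<beta> + 1)))"
    unfolding sum_distrib_left sum.distrib[symmetric]
    by (rule sum.cong) (simp_all add: \<kappa>_def power_add power2_eq_square algebra_simps)
  ultimately show ?thesis
    by simp
qed

lemma digit_sums_p_plus_1_and_p_contradiction:
  assumes n: "n = n0 + p * n1 + p\<^sup>2 * n2 + p ^ 3 * n3"
    and digits: "n0 < p" "n1 < p" "n2 < p" "n3 < p"
    and "n0 + n2 = p + 1" and "n1 + n3 = p"
  shows False
proof -
  have "(\<Sum>x\<in>K. x ^ (0 + p * 1) * ((x + \<theta>) ^ n + (x - \<theta>) ^ n)) =
      - 2 * (coeff (balanced_poly \<theta> n0 n2) (p - 1 - 0) * coeff (balanced_poly (\<theta> ^ p) n1 n3) (p - 1 - 1))"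
  proof (rule sum_conjugate_pair[OF n])
    have "n0 + n1 + n2 + n3 + 0 + 1 = 2 * (p + 1)"
      using assms(6,7) by simp
    then show "even (n0 + n1 + n2 + n3 + 0 + 1)"
      by simp
  qed (use assms(6,7) p_ge_5 in auto)
  also have "(\<Sum>x\<in>K. x ^ (0 + p * 1) * ((x + \<theta>) ^ n + (x - \<theta>) ^ n)) = 0"
    by (rule sum_conjugate_pair_eq_0) (use p_ge_5 in auto)
  finally have "coeff (balanced_poly \<theta> n0 n2) (p - 1 - 0) * coeff (balanced_poly (\<theta> ^ p) n1 n3) (p - 1 - 1) = 0"
    using numerals_nonzero(1) by simp
  moreover have "p - 1 - 0 = n0 + n2 - 2" "p - 1 - 1 = n1 + n3 - 2"
    using assms(6,7) by linarith+
  moreover have "coeff (balanced_poly \<theta> n0 n2) (n0 + n2 - 2) \<noteq> 0"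
    by (rule coeff_balanced_poly_minus_2_nonzero[OF \<theta>_nonzero digits(1,3)]) (simp add: assms(6))
  moreover have "coeff (balanced_poly (\<theta> ^ p) n1 n3) (n1 + n3 - 2) \<noteq> 0"
    by (rule coeff_balanced_poly_minus_2_nonzero[OF _ digits(2,4)]) (simp_all add: assms(7) \<theta>_nonzero)
  ultimately show False
    by (metis mult_eq_0_iff)
qed

lemma digit_sums_1_and_p_plus_1_contradiction:
  assumes n: "n = n0 + p * n1 + p\<^sup>2 * n2 + p ^ 3 * n3"
    and digits: "n0 < p" "n1 < p" "n2 < p" "n3 < p"
    and "n0 + n2 = 1" and "n1 + n3 = p + 1"
  shows False
proof -
  have "(\<Sum>x\<in>K. x ^ (p - 2 + p * 0) * ((x + \<theta>) ^ n + (x - \<theta>) ^ n)) =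
      - 2 * (coeff (balanced_poly \<theta> n0 n2) (p - 1 - (p - 2)) * coeff (balanced_poly (\<theta> ^ p) n1 n3) (p - 1 - 0))"
  proof (rule sum_conjugate_pair[OF n])
    have "n0 + n1 + n2 + n3 + (p - 2) + 0 = 2 * p"
      using assms(6,7) p_ge_5 by linarith
    then show "even (n0 + n1 + n2 + n3 + (p - 2) + 0)"
      by simp
  qed (use assms(6,7) p_ge_5 in auto)
  also have "(\<Sum>x\<in>K. x ^ (p - 2 + p * 0) * ((x + \<theta>) ^ n + (x - \<theta>) ^ n)) = 0"
    by (rule sum_conjugate_pair_eq_0) (use p_ge_5 in auto)
  finally have "coeff (balanced_poly \<theta> n0 n2) (p - 1 - (p - 2)) * coeff (balanced_poly (\<theta> ^ p) n1 n3) (p - 1 - 0) = 0"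
    using numerals_nonzero(1) by simp
  moreover have "p - 1 - (p - 2) = n0 + n2" "p - 1 - 0 = n1 + n3 - 2"
    using assms(6,7) p_ge_5 by linarith+
  moreover have "coeff (balanced_poly (\<theta> ^ p) n1 n3) (n1 + n3 - 2) \<noteq> 0"
    by (rule coeff_balanced_poly_minus_2_nonzero[OF _ digits(2,4)]) (simp_all add: assms(7) \<theta>_nonzero)
  ultimately show False
    by (metis coeff_balanced_poly_top mult_eq_0_iff zero_neq_one)
qed

text \<open>Here \<open>\<kappa>\<close> is a polynomial in \<open>x\<close> of degree at most \<open>p\<close>, too small for the linear moments of
  \<open>remainder_moment_eq_0\<close>. In the norm moment the first term is the norm of the coefficient of
  \<open>x ^ (p - 2)\<close> times \<open>- 80\<close>, and the other two terms vanish. For \<open>p = 5\<close> the factor \<open>80\<close> is zero, but then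
  \<open>n \<equiv> 7\<close> modulo \<open>24\<close> is not divisible by \<open>3\<close>.\<close>

lemma digit_sums_p_plus_2_and_0_contradiction:
  assumes n: "n = n0 + p\<^sup>2 * n2" and digits: "n0 < p" "n2 < p" and sum: "n0 + n2 = p + 2"
  shows False
proof -
  have sq: "p\<^sup>2 = p * p"
    by (rule power2_eq_square)
  have "p \<ge> 7"
  proof (rule ccontr)
    assume "\<not> p \<ge> 7"
    then have "p = 5 \<or> p = 6"
      using p_ge_5 by linarith
    moreover have "p \<noteq> 6"
      using odd_p by auto
    ultimately have p5: "p = 5"
      by simp
    then have n7: "n = 7 + 24 * n2"
      using n sum by simp
    then have "3 dvd n"
      by (intro power_2PN_imp_3_dvd[OF PN]) simp
    then show False
      unfolding n7 by presburger
  qed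
  define P where "P = balanced_poly \<theta> n0 n2 + balanced_poly (- \<theta>) n0 n2 - monom 2 (p + 2)"
  have "degree P \<le> p + 2"
    unfolding P_def
    by (intro degree_diff_le degree_add_le) (simp_all add: degree_balanced_poly sum degree_monom_le)
  moreover have "coeff P (p + 2) = 0"
    using coeff_balanced_poly_top[of \<theta> n0 n2] coeff_balanced_poly_top[of "- \<theta>" n0 n2] sum by (simp add: P_def)
  moreover have "coeff P (p + 1) = 0"
    unfolding P_def coeff_add coeff_diff coeff_balanced_poly_uminus sum by simp
  ultimately have degP: "degree P \<le> p"
    using leading_coeff_0_iff[of P] by (cases "degree P = p + 2"; cases "degree P = p + 1") auto
  have coeffP: "coeff P (p - 2) \<noteq> 0"
  proof -
    have "even (n0 + n2 + (p - 2))"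
      using sum p_ge_5 by simp
    then have "coeff P (p - 2) = 2 * coeff (balanced_poly \<theta> n0 n2) (p - 2)"
      unfolding P_def coeff_add coeff_diff coeff_balanced_poly_uminus by simp
    then show ?thesis
      using coeff_balanced_poly_minus_4_nonzero[OF \<theta>_nonzero digits sum] numerals_nonzero(1) by simp
  qed
  have n': "n = n0 + p * 0 + p\<^sup>2 * n2 + p ^ 3 * 0"
    using n by simp
  have \<kappa>: "\<kappa> x = poly P x" if x: "x \<in> K" for x
    unfolding \<kappa>_def power_digits_split[OF x, of n0 0 n2 0, folded n']
    by (simp add: P_def balanced_poly_def[of _ 0 0] poly_monom power_add power2_eq_square)
  \<comment> \<open>The conjugate polynomial, for which \<open>\<kappa> x ^ p\<close> is a polynomial in \<open>x ^ p\<close>.\<close>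
  define C where "C = map_poly (\<lambda>c. c ^ p) P"
  have C: "poly C (x ^ p) = poly P x ^ p" for x
    unfolding C_def
  proof (induction P)
    case (pCons a P)
    then show ?case
      using p_ge_5 by (simp add: map_poly_pCons p_power_add power_mult_distrib power_0_left)
  qed (use p_ge_5 in \<open>simp add: power_0_left\<close>)
  have degC: "degree C \<le> p"
    unfolding C_def using map_poly_degree_leq degP by (rule le_trans)
  have coeffC: "coeff C (p - 2) = coeff P (p - 2) ^ p"
    unfolding C_def using p_ge_5 by (simp add: coeff_map_poly power_0_left)
  have main: "(\<Sum>x\<in>K. x * x ^ p * \<kappa> x * \<kappa> x ^ p) = - (coeff P (p - 2) * coeff P (p - 2) ^ p)"
  proof -
    have "(\<Sum>x\<in>K. x ^ 1 * (x ^ p) ^ 1 * (poly P x * poly C (x ^ p))) =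
        - (coeff P (p - 1 - 1) * coeff C (p - 1 - 1))"
      by (rule sum_two_variables) (use Q_eq degP degC p_ge_5 in auto)
    moreover have "p - 1 - 1 = p - 2"
      by simp
    ultimately show ?thesis
      by (simp add: C coeffC \<kappa> mult.assoc cong: sum.cong)
  qed
  have side: "(\<Sum>x\<in>K. 16 * (x ^ p)\<^sup>2 * (\<kappa> x)\<^sup>2) = 0"
  proof -
    have "degree (monom 16 (2 * p) * P\<^sup>2) \<le> 2 * p + p * 2"
      by (intro order_trans[OF degree_mult_le] add_mono degree_monom_le order_trans[OF degree_power_le] mult_le_mono1 degP)
    also have "\<dots> < Q - 1"
    proof -
      have "7 * p \<le> p * p"
        using \<open>p \<ge> 7\<close> by simp
      then show ?thesis
        using p_ge_5 unfolding Q_eq sq by linarith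
    qed
    finally have deg: "degree (monom 16 (2 * p) * P\<^sup>2) < Q - 1" .
    have "(\<Sum>x\<in>K. 16 * (x ^ p)\<^sup>2 * (\<kappa> x)\<^sup>2) = (\<Sum>x\<in>K. poly (monom 16 (2 * p) * P\<^sup>2) x)"
      by (rule sum.cong) (simp_all add: \<kappa> poly_monom mult.commute[of 2] flip: power_mult)
    also have "\<dots> = - coeff (monom 16 (2 * p) * P\<^sup>2) (Q - 1)"
      by (rule sum_poly) (use deg in simp)
    also have "\<dots> = 0"
      using deg by (simp add: coeff_eq_0)
    finally show ?thesis .
  qed
  have "(\<Sum>x\<in>K. 16 * x\<^sup>2 * (\<kappa> x ^ p)\<^sup>2) = (\<Sum>x\<in>K. 16 * (x ^ p)\<^sup>2 * (\<kappa> x)\<^sup>2) ^ p"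
  proof -
    have "(16 * (x ^ p)\<^sup>2 * (\<kappa> x)\<^sup>2) ^ p = 16 * x\<^sup>2 * (\<kappa> x ^ p)\<^sup>2" if "x \<in> K" for x
    proof -
      have "(y\<^sup>2) ^ p = (y ^ p)\<^sup>2" for y :: 'a
        by (simp add: mult.commute flip: power_mult)
      then show ?thesis
        using K_power_p_p[OF that] frobenius_numeral[of _ 1] by (simp add: power_mult_distrib)
    qed
    then show ?thesis
      using frobenius_sum[of "\<lambda>x. 16 * (x ^ p)\<^sup>2 * (\<kappa> x)\<^sup>2" K 1] by simp
  qed
  then have "(\<Sum>x\<in>K. 16 * x\<^sup>2 * (\<kappa> x ^ p)\<^sup>2) = 0"
    unfolding side using p_ge_5 by (simp add: power_0_left)
  then have "80 * (coeff P (p - 2) * coeff P (p - 2) ^ p) = 0"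
    using remainder_norm_moment_eq_0[OF \<open>p \<ge> 7\<close>] side main
    unfolding sum.distrib sum_distrib_left[symmetric] by simp
  moreover have "(80::'a) \<noteq> 0"
  proof -
    have "(80::'a) = 4 * (4 * of_nat 5)"
      by simp
    then show ?thesis
      using numerals_nonzero(3) of_nat_nonzero[of 5] \<open>p \<ge> 7\<close> by (metis mult_eq_0_iff zero_less_numeral less_le_trans numeral_less_iff semiring_norm)
  qed
  ultimately show False
    using coeffP by simp
qed

lemma exponent_2_plus_p_contradiction:
  assumes n: "n = n0 + p * n1 + p\<^sup>2 * n2 + p ^ 3 * n3"
    and digits: "n0 < p" "n1 < p" "n2 < p" "n3 < p"
    and sum: "n0 + n2 + p * (n1 + n3) = p + 2 \<or> n0 + n2 + p * (n1 + n3) = p\<^sup>2 + p + 1"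
  shows False
proof -
  have lt: "n0 + n2 \<le> 2 * p - 2"
    using digits by linarith
  have sq: "p\<^sup>2 = p * p"
    by (rule power2_eq_square)
  have p5: "5 * p \<le> p * p"
    using p_ge_5 by simp
  consider "n0 + n2 = 2" "n1 + n3 = 1" | "n0 + n2 = p + 2" "n1 + n3 = 0"
    | "n0 + n2 = 1" "n1 + n3 = p + 1" | "n0 + n2 = p + 1" "n1 + n3 = p"
    using sum
  proof
    assume s: "n0 + n2 + p * (n1 + n3) = p + 2"
    then have "p * (n1 + n3) < p * 2"
      using p_ge_5 by linarith
    then have "n1 + n3 = 0 \<or> n1 + n3 = 1"
      by auto
    then show thesis
      using s that(1,2) by auto
  next
    assume s: "n0 + n2 + p * (n1 + n3) = p\<^sup>2 + p + 1"
    then have "p * (p - 1) < p * (n1 + n3)"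
      using lt p5 p_ge_5 unfolding sq diff_mult_distrib2 by linarith
    moreover have "p * (n1 + n3) < p * (p + 2)"
      using s p_ge_5 unfolding sq distrib_left by linarith
    ultimately have "p - 1 < n1 + n3" "n1 + n3 < p + 2"
      by (simp_all only: mult_less_cancel1)
    then have "n1 + n3 = p \<or> n1 + n3 = p + 1"
      by linarith
    then show thesis
    proof
      assume B: "n1 + n3 = p"
      then have "n0 + n2 = p + 1"
        using s unfolding sq B by simp
      then show thesis
        using B by (rule that(4))
    next
      assume B: "n1 + n3 = p + 1"
      then have "n0 + n2 = 1"
        using s unfolding sq B by simp
      then show thesis
        using B by (rule that(3))
    qed
  qed
  then show False
  proof cases
    case 1
    then show False
      by (rule digit_sums_2_and_1_contradiction[OF n])
  next
    case 2
    then show False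
      using digit_sums_p_plus_2_and_0_contradiction[of n0 n2] n digits by simp
  next
    case 3
    then show False
      by (rule digit_sums_1_and_p_plus_1_contradiction[OF n digits])
  next
    case 4
    then show False
      by (rule digit_sums_p_plus_1_and_p_contradiction[OF n digits])
  qed
qed

end

section \<open>Residues of the exponent and the classification\<close>

context quartic_field
begin

lemma power_mod_on_fixed_field:
  assumes "x \<in> fixed_field R" and "n mod (R - 1) = m mod (R - 1)" and "0 < n" and "0 < m" and "2 \<le> R"
  shows "(x::'a) ^ n = x ^ m"
proof (cases "x = 0")
  case False
  have "x ^ (R - 1) * x = 1 * x"
    using assms(1,5) power_minus_mult[of R x] by (simp add: fixed_field_def)
  then have one: "x ^ (R - 1) = 1"
    using False by (metis mult_right_cancel)
  have "x ^ k = x ^ (k mod (R - 1))" for k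
  proof -
    have "x ^ k = x ^ (k div (R - 1) * (R - 1) + k mod (R - 1))"
      by (simp only: div_mult_mod_eq)
    also have "\<dots> = x ^ (k mod (R - 1))"
      unfolding power_add mult.commute[of _ "R - 1"] power_mult one by simp
    finally show ?thesis .
  qed
  then show ?thesis
    using assms(2) by metis
qed (use assms in \<open>simp add: power_0_left\<close>)

lemma power_2PN_mod_p_minus_1:
  assumes "power_2PN n" and "0 < n"
  shows "n mod (p - 1) = 3"
proof -
  interpret quartic_subfield p F p
    by unfold_locales simp
  define r where "r = (n - 1) mod (p - 1) + 1"
  have "n mod (p - 1) = r mod (p - 1)"
    using assms(2) unfolding r_def by (metis One_nat_def Suc_pred add.commute mod_Suc_eq plus_1_eq_Suc)
  moreover have "1 \<le> r" "r \<le> p - 1"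
    using p_ge_5 by (auto simp: r_def Suc_le_eq)
  moreover have "x ^ n = x ^ r" if "x \<in> K" for x
    by (rule power_mod_on_fixed_field[OF that]) (use calculation assms p_ge_5 in auto)
  ultimately have "r = 3"
    using exponent_eq_3_over_prime_field[OF assms(1)] by blast
  then show ?thesis
    using \<open>n mod (p - 1) = r mod (p - 1)\<close> p_ge_5 by simp
qed

text \<open>Modulo \<open>p - 1\<close> a number is congruent to the sum of its base \<open>p\<close> digits, so the two digits of the residue of
  \<open>n\<close> add up to \<open>3\<close> or \<open>p + 2\<close>.\<close>

lemma power_2PN_mod_p2_minus_1:
  assumes "power_2PN n" and "0 < n"
  obtains m where "m \<in> {3, p + 2, 2 * p + 1, 3 * p}" "n mod (p\<^sup>2 - 1) = m mod (p\<^sup>2 - 1)"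
proof -
  interpret quartic_subfield p F p
    by unfold_locales simp
  have sq: "p\<^sup>2 = p * p" "5 * p \<le> p * p"
    using p_ge_5 by (auto simp: power2_eq_square)
  define m where "m = (n - 1) mod (p\<^sup>2 - 1) + 1"
  have "(n - 1) mod (p\<^sup>2 - 1) < p\<^sup>2 - 1"
    using sq p_ge_5 by (intro mod_less_divisor) linarith
  then have m: "1 \<le> m" "m < p * p"
    using sq by (auto simp: m_def)
  have nm: "n mod (p\<^sup>2 - 1) = m mod (p\<^sup>2 - 1)"
    using assms(2) unfolding m_def by (metis One_nat_def Suc_pred add.commute mod_Suc_eq plus_1_eq_Suc)
  define u v where "u = m mod p" and "v = m div p"
  have uv: "u < p" "v < p" "m = u + p * v"
    using m p_ge_5 by (auto simp: u_def v_def div_less_iff_less_mult)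
  have dvd: "p - 1 dvd p\<^sup>2 - 1"
  proof
    show "p\<^sup>2 - 1 = (p - 1) * (p + 1)"
      using p_ge_5 by (cases p) (simp_all add: power2_eq_square)
  qed
  have "m mod (p - 1) = n mod (p - 1)"
    using arg_cong[OF nm, of "\<lambda>k. k mod (p - 1)"] dvd by (simp add: mod_mod_cancel)
  then have m3: "m mod (p - 1) = 3"
    using power_2PN_mod_p_minus_1[OF assms] by simp
  have "m = u + v + (p - 1) * v"
    using uv(3) p_ge_5 by (cases p) simp_all
  then have uv3: "(u + v) mod (p - 1) = 3"
    using m3 by (metis mod_mult_self2)
  have "u + v = 3 \<or> u + v = p + 2"
  proof -
    have "u + v = (p - 1) * ((u + v) div (p - 1)) + 3"
      using uv3 by (metis mult_div_mod_eq)
    moreover have "(u + v) div (p - 1) \<le> 1"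
    proof -
      have "u + v < 2 * (p - 1) + 3"
        using uv by linarith
      then have "(p - 1) * ((u + v) div (p - 1)) < (p - 1) * 2"
        using calculation by linarith
      then show ?thesis
        by simp
    qed
    then have "(u + v) div (p - 1) = 0 \<or> (u + v) div (p - 1) = 1"
      by linarith
    ultimately show ?thesis
      using p_ge_5 by auto
  qed
  moreover have "u + v \<noteq> p + 2"
  proof
    assume sum: "u + v = p + 2"
    obtain \<theta> :: 'a where \<theta>: "\<theta> \<noteq> 0" "\<theta> ^ p = - \<theta>"
      by (rule obtain_anti_invariant)
    have pneg: "(- y :: 'a) ^ p = - (y ^ p)" for y
      using frobenius_minus[of y 1] by simp
    have \<theta>2: "\<theta> ^ p\<^sup>2 = \<theta>"
      unfolding sq power_mult by (simp add: \<theta> pneg)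
    have big: "z \<in> fixed_field (p\<^sup>2)" if "z = x + \<theta> \<or> z = x - \<theta>" "x \<in> K" for x z
    proof -
      have "x ^ p\<^sup>2 = x"
        using that(2) unfolding sq power_mult fixed_field_def by simp
      then show ?thesis
        using that(1) \<theta>2 by (auto simp: fixed_field_def frobenius_add frobenius_diff)
    qed
    have z: "z ^ n = z ^ u * (z ^ p) ^ v" if "z \<in> fixed_field (p\<^sup>2)" for z :: 'a
    proof -
      have "z ^ n = z ^ m"
        by (rule power_mod_on_fixed_field[OF that nm]) (use assms m sq p_ge_5 in auto)
      then show ?thesis
        unfolding uv(3) power_add power_mult .
    qed
    have xp: "(x + \<theta>) ^ p = x - \<theta>" "(x - \<theta>) ^ p = x + \<theta>" if "x \<in> K" for x
      using that \<theta> by (simp_all add: add_power_Q diff_power_Q fixed_field_def)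
    show False
    proof (rule digit_sum_p_plus_2_contradiction[OF assms(1) refl \<theta> _ uv(1,2) sum])
      show "x ^ n = x ^ 3" if "x \<in> K" for x
        by (rule power_mod_on_fixed_field[OF that])
           (use power_2PN_mod_p_minus_1[OF assms] assms(2) p_ge_5 in auto)
      show "(x + \<theta>) ^ n = (x + \<theta>) ^ u * (x - \<theta>) ^ v" if "x \<in> K" for x
        using z[OF big[of "x + \<theta>" x]] that xp by simp
      show "(x - \<theta>) ^ n = (x - \<theta>) ^ u * (x + \<theta>) ^ v" if "x \<in> K" for x
        using z[OF big[of "x - \<theta>" x]] that xp by simp
    qed
  qed
  ultimately have "u + v = 3"
    by simp
  then have "v = 0 \<and> u = 3 \<or> v = 1 \<and> u = 2 \<or> v = 2 \<and> u = 1 \<or> v = 3 \<and> u = 0"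
    by presburger
  then have "m \<in> {3, p + 2, 2 * p + 1, 3 * p}"
    unfolding uv(3) by (elim disjE) simp_all
  then show thesis
    using nm by (rule that)
qed

text \<open>The two base \<open>p\<^sup>2\<close> digits \<open>U\<close>, \<open>V\<close> of \<open>n\<close> satisfy \<open>U + V \<equiv> m\<close> modulo \<open>p\<^sup>2 - 1\<close>, so \<open>U + V\<close> is \<open>m\<close> or
  \<open>m + p\<^sup>2 - 1\<close>.\<close>

lemma power_2PN_imp_exponent_of_mod:
  assumes "power_2PN n" and "0 < n" and "n < p ^ 4"
    and m: "m = 3 \<or> m = p + 2" and nm: "n mod (p\<^sup>2 - 1) = m mod (p\<^sup>2 - 1)"
  shows "n \<in> {3, 2 + p\<^sup>2, 1 + 2 * p\<^sup>2, 3 * p\<^sup>2}"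
proof -
  interpret quartic_subfield p F "p\<^sup>2"
    by unfold_locales simp
  obtain \<theta> :: 'a where \<theta>: "\<theta> \<noteq> 0" "\<theta> ^ p\<^sup>2 = - \<theta>"
    by (rule obtain_anti_invariant)
  interpret quadratic_subfield p F "p\<^sup>2" \<theta>
    by unfold_locales (use \<theta> in auto)
  have sq: "p\<^sup>2 = p * p" "5 * p \<le> p * p"
    using p_ge_5 by (auto simp: power2_eq_square)
  define U V where "U = n mod p\<^sup>2" and "V = n div p\<^sup>2"
  have "n < p\<^sup>2 * p\<^sup>2"
    using assms(3) by (simp flip: power_add)
  then have UV: "U < p\<^sup>2" "V < p\<^sup>2" "n = U + p\<^sup>2 * V"
    using p_ge_5 by (auto simp: U_def V_def div_less_iff_less_mult)
  define n0 n1 n2 n3 where "n0 = U mod p" and "n1 = U div p" and "n2 = V mod p" and "n3 = V div p"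
  have digits: "n0 < p" "n1 < p" "n2 < p" "n3 < p"
    using UV p_ge_5 sq by (auto simp: n0_def n1_def n2_def n3_def div_less_iff_less_mult)
  have U: "U = n0 + p * n1" and V: "V = n2 + p * n3"
    by (simp_all add: n0_def n1_def n2_def n3_def)
  have n: "n = n0 + p * n1 + p\<^sup>2 * n2 + p ^ 3 * n3"
    unfolding UV(3) U V by (simp add: power2_eq_square power3_eq_cube algebra_simps)
  have sumUV: "n0 + n2 + p * (n1 + n3) = U + V"
    unfolding U V by (simp add: algebra_simps)
  have mlt: "m < p\<^sup>2 - 1" "0 < m"
  proof -
    have "p + 3 < p\<^sup>2"
      using sq p_ge_5 by linarith
    moreover have "m \<le> p + 2" "0 < m"
      using m p_ge_5 by auto
    ultimately show "m < p\<^sup>2 - 1" "0 < m"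
      by linarith+
  qed
  have "n = U + V + (p\<^sup>2 - 1) * V"
    unfolding UV(3) using sq p_ge_5 by (simp add: algebra_simps)
  then have "(U + V) mod (p\<^sup>2 - 1) = m"
    using nm mlt by (metis mod_mult_self2 mod_less)
  then have eq: "U + V = (p\<^sup>2 - 1) * ((U + V) div (p\<^sup>2 - 1)) + m"
    by (metis mult_div_mod_eq)
  have "(p\<^sup>2 - 1) * ((U + V) div (p\<^sup>2 - 1)) < (p\<^sup>2 - 1) * 2"
    using UV(1,2) eq mlt(2) by linarith
  then have "(U + V) div (p\<^sup>2 - 1) < 2"
    by simp
  then consider "U + V = m" | "U + V = p\<^sup>2 - 1 + m"
    using eq by (auto simp: less_2_cases_iff)
  then have cases: "U + V = m \<or> U + V = p\<^sup>2 - 1 + m"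
    by blast
  have pow: "x ^ n = x ^ m" if "x \<in> K" for x
    by (rule power_mod_on_fixed_field[OF that nm]) (use assms mlt sq p_ge_5 in auto)
  from m show ?thesis
  proof
    assume m3: "m = 3"
    have "U + V \<noteq> p\<^sup>2 - 1 + 3"
    proof
      assume "U + V = p\<^sup>2 - 1 + 3"
      then have "n0 + n2 + p * (n1 + n3) = p\<^sup>2 + 2"
        using sumUV sq p_ge_5 by linarith
      then show False
        using cubic_carry_contradiction[OF assms(1) n digits] pow m3 by blast
    qed
    then have "U + V = 3"
      using cases m3 by simp
    then have "V = 0 \<and> U = 3 \<or> V = 1 \<and> U = 2 \<or> V = 2 \<and> U = 1 \<or> V = 3 \<and> U = 0"
      by presburger
    then show ?thesis
      unfolding UV(3) by (elim disjE) simp_all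
  next
    assume m2: "m = p + 2"
    interpret degree_2_plus_p p F "p\<^sup>2" \<theta> n
    proof
      show "x ^ n = x\<^sup>2 * x ^ p" if "x \<in> K" for x
        using pow[OF that] unfolding m2 power_add by (simp only: mult.commute)
    qed (rule assms(1))
    have top: "p\<^sup>2 - 1 + m = p\<^sup>2 + p + 1"
      using m2 sq p_ge_5 by linarith
    then have "n0 + n2 + p * (n1 + n3) = p + 2 \<or> n0 + n2 + p * (n1 + n3) = p\<^sup>2 + p + 1"
      using cases unfolding sumUV top unfolding m2 by blast
    then show ?thesis
      using exponent_2_plus_p_contradiction[OF n digits] by blast
  qed
qed

text \<open>The second differences of the new power are those of \<open>x ^ n\<close> followed by the Frobenius automorphism.\<close>

lemma power_2PN_twist:
  assumes "power_2PN n" and pow: "\<And>x::'a. x ^ n' = (x ^ n) ^ p"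
  shows "power_2PN n'"
  unfolding power_2PN_def
proof (intro allI impI injI)
  fix a b x y :: 'a
  assume ab: "a \<noteq> 0" "b \<noteq> 0" and eq: "second_difference n' a b x = second_difference n' a b y"
  have sd: "second_difference n' a b z = second_difference n a b z ^ p" for z
    using frobenius_add[of _ _ 1] frobenius_diff[of _ _ 1] by (simp add: second_difference_def pow)
  have "(second_difference n a b x - second_difference n a b y) ^ p = 0"
    using eq frobenius_diff[of _ _ 1] by (simp add: sd)
  then have "second_difference n a b x = second_difference n a b y"
    by simp
  moreover have "inj (second_difference n a b)"
    using assms(1) ab by (simp add: power_2PN_def)
  ultimately show "x = y"
    by (rule injD[rotated])
qed

lemma power_2PN_imp_exponent:
  assumes "power_2PN n" and "n \<le> p ^ 4 - 1" and "\<not> p dvd n"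
  shows "n \<in> {3, 2 + p\<^sup>2, 1 + 2 * p\<^sup>2}"
proof -
  have n0: "0 < n"
    using assms(3) by (auto intro: Nat.gr0I)
  have "0 < p ^ 4"
    using p_ge_5 by simp
  then have n_less: "n < p ^ 4"
    using assms(2) by linarith
  have sq: "p\<^sup>2 = p * p" "5 * p \<le> p * p"
    using p_ge_5 by (auto simp: power2_eq_square)
  obtain m where m: "m \<in> {3, p + 2, 2 * p + 1, 3 * p}" and nm: "n mod (p\<^sup>2 - 1) = m mod (p\<^sup>2 - 1)"
    using power_2PN_mod_p2_minus_1[OF assms(1) n0] by blast
  show ?thesis
  proof (cases "m = 3 \<or> m = p + 2")
    case True
    then have "n \<in> {3, 2 + p\<^sup>2, 1 + 2 * p\<^sup>2, 3 * p\<^sup>2}"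
      by (rule power_2PN_imp_exponent_of_mod[OF assms(1) n0 n_less _ nm])
    moreover have "n \<noteq> 3 * p\<^sup>2"
      using assms(3) by (auto simp: sq)
    ultimately show ?thesis
      by simp
  next
    case False
    \<comment> \<open>The number \<open>n'\<close> arises from \<open>n\<close> by a cyclic shift of its four base \<open>p\<close> digits, which is multiplication by
      \<open>p\<close> modulo \<open>p ^ 4 - 1\<close>. Its second digit is the last digit of \<open>n\<close>, and so is not \<open>0\<close>.\<close>
    define a b n' where "a = n div p ^ 3" and "b = n mod p ^ 3" and "n' = a + p * b"
    have p4: "p ^ 4 = p * p ^ 3" "0 < p ^ 3"
      using p_ge_5 by (auto simp: power_numeral_reduce)
    have "n < p * p ^ 3"
      using n_less by (simp only: p4(1))
    then have ab: "a < p" "b < p ^ 3" "n = a * p ^ 3 + b"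
      using p4(2) unfolding a_def b_def by (simp_all only: div_less_iff_less_mult mod_less_divisor div_mult_mod_eq)
    have np: "n * p = n' + (p ^ 4 - 1) * a"
    proof -
      have "(p ^ 4 - 1) * a + 1 * a = p ^ 4 * a"
        unfolding distrib_right[symmetric] using \<open>0 < p ^ 4\<close> by simp
      moreover have "n * p = p ^ 4 * a + p * b"
        unfolding ab(3) p4(1) by (simp only: algebra_simps)
      ultimately show ?thesis
        unfolding n'_def by linarith
    qed
    have "p dvd p ^ 3"
      by (simp add: dvd_power)
    then have "p dvd a * p ^ 3"
      by (rule dvd_mult)
    then have "\<not> p dvd b"
      using assms(3) unfolding ab(3) by (simp add: dvd_add_right_iff)
    then have "0 < b"
      by (auto intro: Nat.gr0I)
    then have n'0: "0 < n'"
      using p_ge_5 by (simp add: n'_def)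
    have "p * (b + 1) \<le> p * p ^ 3"
      using ab(2) by (intro mult_le_mono2) simp
    then have n'_less: "n' < p ^ 4"
      using ab(1) unfolding n'_def p4 by simp
    have pow: "x ^ n' = (x ^ n) ^ p" for x :: 'a
    proof (cases "x = 0")
      case False
      have "x ^ (n * p) = x ^ n' * (x ^ (CARD('a) - 1)) ^ a"
        unfolding np card by (simp add: power_add power_mult)
      then show ?thesis
        using power_card_minus_1_eq_1[OF False] by (simp add: power_mult)
    qed (use n0 n'0 p_ge_5 in \<open>simp add: power_0_left\<close>)
    have dvd: "p\<^sup>2 - 1 dvd p ^ 4 - 1"
    proof
      have "p ^ 4 = p\<^sup>2 * p\<^sup>2"
        by (simp flip: power_add)
      then show "p ^ 4 - 1 = (p\<^sup>2 - 1) * (p\<^sup>2 + 1)"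
        by (simp add: algebra_simps)
    qed
    have "n' mod (p\<^sup>2 - 1) = (n' + (p ^ 4 - 1) * a) mod (p\<^sup>2 - 1)"
      using dvd by (auto elim!: dvdE simp: mult.assoc)
    also have "\<dots> = (m * p) mod (p\<^sup>2 - 1)"
      unfolding np[symmetric] using nm by (metis mod_mult_left_eq)
    finally have n'_mod: "n' mod (p\<^sup>2 - 1) = (m * p) mod (p\<^sup>2 - 1)" .
    have "m = 2 * p + 1 \<or> m = 3 * p"
      using m False by auto
    then obtain m' where m': "m' = 3 \<or> m' = p + 2" "(m * p) mod (p\<^sup>2 - 1) = m' mod (p\<^sup>2 - 1)"
    proof
      assume "m = 2 * p + 1"
      then have "m * p = 2 * (p * p) + p"
        by (simp add: algebra_simps)
      then have "m * p = p + 2 + (p\<^sup>2 - 1) * 2"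
        using sq(2) p_ge_5 unfolding sq(1) diff_mult_distrib by linarith
      then show thesis
        using that[of "p + 2"] by (metis mod_mult_self2)
    next
      assume "m = 3 * p"
      then have "m * p = 3 * (p * p)"
        by simp
      then have "m * p = 3 + (p\<^sup>2 - 1) * 3"
        using sq(2) p_ge_5 unfolding sq(1) diff_mult_distrib by linarith
      then show thesis
        using that[of 3] by (metis mod_mult_self2)
    qed
    have "n' mod (p\<^sup>2 - 1) = m' mod (p\<^sup>2 - 1)"
      using n'_mod m'(2) by simp
    with power_2PN_twist[OF assms(1) pow] n'0 n'_less m'(1)
    have "n' \<in> {3, 2 + p\<^sup>2, 1 + 2 * p\<^sup>2, 3 * p\<^sup>2}"
      by (rule power_2PN_imp_exponent_of_mod)
    then have "n' \<in> {3 + p * (p * 0), 2 + p * (p * 1), 1 + p * (p * 2), 0 + p * (p * 3)}"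
      by (auto simp: sq(1) algebra_simps)
    then obtain c d where "n' = c + p * (p * d)" "c < p"
      using p_ge_5 by fastforce
    then have "p dvd n' div p"
      using p_ge_5 by (simp add: div_mult_self2)
    moreover have "n' div p = b"
      using ab(1) p_ge_5 by (simp add: n'_def)
    ultimately show ?thesis
      using \<open>\<not> p dvd b\<close> by simp
  qed
qed

end

theorem theorem1p5:
  fixes p n :: nat
  assumes "prime p" and "p \<ge> 5"
    and "CARD('a::{finite, field}) = p ^ 4"
    and "n \<le> p ^ 4 - 1" and "\<not> p dvd n"
    and "k_PN 2 (monom (1::'a) n)"
  shows "n \<in> {3, 2 + p\<^sup>2, 1 + 2 * p\<^sup>2}"
proof -
  interpret quartic_field p "TYPE('a)"
    by unfold_locales (use assms in auto)
  have "power_2PN n"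
    unfolding power_2PN_def
  proof (intro allI impI)
    fix a b :: 'a
    assume ab: "a \<noteq> 0" "b \<noteq> 0"
    define d where "d i = (if i = 1 then a else b)" for i :: nat
    have "bij (poly (finite_difference 2 d (monom 1 n)))"
      using assms(6) ab by (simp add: k_PN_def d_def)
    moreover have "poly (finite_difference 2 d (monom 1 n)) = second_difference n a b"
      by (rule ext)
         (simp add: numeral_2_eq_2 Let_def d_def poly_pcompose poly_monom second_difference_def algebra_simps)
    ultimately show "inj (second_difference n a b)"
      by (simp add: bij_is_inj)
  qed
  then show ?thesis
    using assms(4,5) by (rule power_2PN_imp_exponent)
qed

end
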